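(* Let $m,n,k$ be positive integers with $k\le\min\{m,n\}$, $A=[a_{i,j}]\in\mathbb{R}^{m\times n}$, $W=[w_{i,j}]\in\mathbb{R}^{m\times n}$ with $w_{i,j}\ge0$ and $\sum_{i,j}w_{i,j}=1$, and $\lambda>0$. Let $(U_0,\mathbf x_0,V_0)\in\mathcal M=V_k(\mathbb{R}^m)\times\mathbb{R}^k\times V_k(\mathbb{R}^n)$ and $K\ge1$. Put $$\alpha=\max_{i,j}a_{i,j}^2,\qquad \rho_0=\max\Big\{\|\mathbf x_0\|^2,\frac{\alpha}{4\lambda}\Big\},$$ $$\Phi_{\min}=K\max\Big\{(\lambda+2\sqrt\lambda+1)\alpha,\ \sqrt{32k\alpha\lambda+8k(2+\lambda^2)\Big(2\lambda\rho_0+\frac{\pi^2+12}{6}\Big)}\Big\}.$$ Let $\{(\eta_t,\gamma_t)\}_{t=0}^\infty$ be independent random elements of $\Omega_{m,n}=\{1,\dots,m\}\times\{1,\dots,n\}$, each with distribution $\mu(\{(i,j)\})=w_{i,j}$, and define recursively $$(U_{t+1},\mathbf x_{t+1},V_{t+1})=R_{(U_t,\mathbf x_t,V_t)}\Big(-\frac{1}{(t+1)\Phi_{\min}}\nabla g_{\eta_t,\gamma_t}(U_t,\mathbf x_t,V_t)\Big),\quad t\ge0.$$ Then: (1) $\{(U_t,\mathbf x_t,V_t)\}_{t=0}^\infty$ is contained in the compact subset $\{(U,\mathbf x,V)\in\mathcal M:\|\mathbf x\|^2\le\rho_0+\frac{\pi^2+12}{12\lambda}\}$ of $\mathcal M$;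 therefore it has convergent subsequences; (2) $\{G(U_t,\mathbf x_t,V_t)\}_{t=0}^\infty$ converges almost surely to a finite number; (3) $\{\|\nabla G(U_t,\mathbf x_t,V_t)\|\}_{t=0}^\infty$ converges almost surely to $0$; (4) any limit point of $\{(U_t,\mathbf x_t,V_t)\}_{t=0}^\infty$ is almost surely a stationary point of $G$.
   Context: $V_k(\mathbb{R}^n)=\{V\in\mathbb{R}^{n\times k}:V^TV=I_k\}$ is the Stiefel manifold, a Riemannian submanifold of $\mathbb{R}^{n\times k}$ (Frobenius inner product), with $T_XV_k(\mathbb{R}^n)=\{Z\in\mathbb{R}^{n\times k}:X^TZ+Z^TX=0\}$. $\mathcal M=V_k(\mathbb{R}^m)\times\mathbb{R}^k\times V_k(\mathbb{R}^n)$ carries the Riemannian metric induced from $\mathbb{R}^{m\times k}\times\mathbb{R}^k\times\mathbb{R}^{n\times k}$; $\nabla$ denotes the Riemannian gradient on $\mathcal M$. For $\mathbf x=[x_1,\dots,x_k]^T\in\mathbb{R}^k$, $D^{k\times k}_k(\mathbf x)$ is the $k\times k$ diagonal matrix with diagonal entries $x_1,\dots,x_k$, and $\|\mathbf x\|$ is the Euclidean norm. For $(U,\mathbf x,V)\in\mathcal M$ write $[p_{i,j}]=UD^{k\times k}_k(\mathbf x)V^T\in\mathbb{R}^{m\times n}$. Define $$g_{\eta,\gamma}(U,\mathbf x,V)=(a_{\eta,\gamma}-p_{\eta,\gamma})^2+\lambda\|\mathbf x\|^2\ \text{ for }(\eta,\gamma)\in\Omega_{m,n},\qquad G(U,\mathbf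 x,V)=\sum_{i=1}^m\sum_{j=1}^n w_{i,j}(a_{i,j}-p_{i,j})^2+\lambda\|\mathbf x\|^2.$$ For a matrix $C$ with linearly independent columns, $\mathrm{qf}(C)$ is the factor $Q$ in the decomposition $C=QT$ with $Q$ having orthonormal columns and $T$ square upper triangular with positive diagonal entries. The retraction $R$ on $\mathcal M$ is $R_{(U,\mathbf x,V)}(Y,\hat{\mathbf x},Z)=(\mathrm{qf}(U+Y),\mathbf x+\hat{\mathbf x},\mathrm{qf}(V+Z))$ for $(Y,\hat{\mathbf x},Z)\in T_UV_k(\mathbb{R}^m)\times\mathbb{R}^k\times T_VV_k(\mathbb{R}^n)$. *)

theory Defs
  imports "HOL-Probability.Probability"
begin

text \<open>
  The dimensions \<open>m\<close>, \<open>n\<close>, \<open>k\<close> are the cardinalities of the index types \<open>'m\<close>, \<open>'n\<close>, \<open>'k\<close>, and an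
  \<open>m \<times> k\<close> matrix has type \<open>real ^ 'k ^ 'm\<close>. The library's inner products on these types and on
  their products are the Frobenius inner product and its sum over the components, i.e. the
  metric that the submanifolds below inherit. The column index type \<open>'k\<close> is linearly ordered
  wherever triangular matrices occur.
\<close>

type_synonym ('m, 'n, 'k) triple = "(real ^ 'k ^ 'm) \<times> (real ^ 'k) \<times> (real ^ 'k ^ 'n)"

definition stiefel :: "(real ^ 'k ^ 'n) set" where
  "stiefel = {V. transpose V ** V = mat 1}"

definition stiefel_tangent :: "real ^ 'k ^ 'n \<Rightarrow> (real ^ 'k ^ 'n) set" where
  "stiefel_tangent X = {Z. transpose X ** Z + transpose Z ** X = 0}"

definition manifold_M :: "('m::finite, 'n::finite, 'k::finite) triple set" where
  "manifold_M = stiefel \<times> UNIV \<times> stiefel"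

definition tangent_M :: "('m::finite, 'n::finite, 'k::finite) triple \<Rightarrow> ('m, 'n, 'k) triple set" where
  "tangent_M = (\<lambda>(U, x, V). stiefel_tangent U \<times> UNIV \<times> stiefel_tangent V)"

text \<open>
  The Riemannian gradient of \<open>f\<close> at \<open>p\<close> is the tangent vector \<open>z\<close> with \<open>\<langle>z, \<xi>\<rangle> = Df(p)[\<xi>]\<close> for all
  tangent vectors \<open>\<xi>\<close>. The differential is intrinsic: \<open>Df(p)[\<xi>]\<close> is the derivative at \<open>0\<close>
  of \<open>f\<close> along any curve in the manifold that passes through \<open>p\<close> with velocity \<open>\<xi>\<close>, so only the
  values of \<open>f\<close> on the manifold matter.
\<close>
definition riem_grad ::
  "(('m::finite, 'n::finite, 'k::finite) triple \<Rightarrow> real) \<Rightarrow> ('m, 'n, 'k) triple \<Rightarrow> ('m, 'n, 'k) triple" where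
  "riem_grad f p = (THE z. z \<in> tangent_M p \<and>
     (\<forall>\<xi>\<in>tangent_M p. \<forall>c :: real \<Rightarrow> ('m, 'n, 'k) triple.
        (\<forall>t. c t \<in> manifold_M) \<and> c 0 = p \<and> (c has_vector_derivative \<xi>) (at 0) \<longrightarrow>
        ((\<lambda>t. f (c t)) has_real_derivative (z \<bullet> \<xi>)) (at 0)))"

definition stationary_point ::
  "(('m::finite, 'n::finite, 'k::finite) triple \<Rightarrow> real) \<Rightarrow> ('m, 'n, 'k) triple \<Rightarrow> bool" where
  "stationary_point f p \<longleftrightarrow> p \<in> manifold_M \<and> riem_grad f p = 0"

definition diag_mat :: "real ^ 'k \<Rightarrow> real ^ 'k ^ 'k" where
  "diag_mat x = (\<chi> i j. if i = j then x $ i else 0)"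

definition p_mat :: "('m::finite, 'n::finite, 'k::finite) triple \<Rightarrow> real ^ 'n ^ 'm" where
  "p_mat = (\<lambda>(U, x, V). U ** diag_mat x ** transpose V)"

definition g_loss ::
  "real ^ 'n ^ 'm \<Rightarrow> real \<Rightarrow> 'm \<times> 'n \<Rightarrow> ('m::finite, 'n::finite, 'k::finite) triple \<Rightarrow> real" where
  "g_loss A lam = (\<lambda>(\<eta>, \<gamma>) (U, x, V).
     (A $ \<eta> $ \<gamma> - p_mat (U, x, V) $ \<eta> $ \<gamma>)\<^sup>2 + lam * (norm x)\<^sup>2)"

definition G_loss ::
  "real ^ 'n ^ 'm \<Rightarrow> real ^ 'n ^ 'm \<Rightarrow> real \<Rightarrow> ('m::finite, 'n::finite, 'k::finite) triple \<Rightarrow> real" where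
  "G_loss A W lam = (\<lambda>(U, x, V).
     (\<Sum>i\<in>UNIV. \<Sum>j\<in>UNIV. W $ i $ j * (A $ i $ j - p_mat (U, x, V) $ i $ j)\<^sup>2)
       + lam * (norm x)\<^sup>2)"

definition upper_triangular :: "real ^ 'k::{finite,linorder} ^ 'k::{finite,linorder} \<Rightarrow> bool" where
  "upper_triangular T \<longleftrightarrow> (\<forall>i j. j < i \<longrightarrow> T $ i $ j = 0)"

definition qf :: "real ^ 'k::{finite,linorder} ^ 'n \<Rightarrow> real ^ 'k::{finite,linorder} ^ 'n" where
  "qf C = (THE Q. transpose Q ** Q = mat 1 \<and>
     (\<exists>T. C = Q ** T \<and> upper_triangular T \<and> (\<forall>i. 0 < T $ i $ i)))"

definition retraction_M ::
  "('m::finite, 'n::finite, 'k::{finite,linorder}) triple \<Rightarrow> ('m, 'n, 'k) triple \<Rightarrow> ('m, 'n, 'k) triple" where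
  "retraction_M = (\<lambda>(U, x, V) (Y, y, Z). (qf (U + Y), x + y, qf (V + Z)))"

end

(*
With s_t = 1 / ((t + 1) Phi), the quantity max (|x_t|^2, alpha / (4 lambda)) grows by at most a
multiple of 1 / (t + 1)^2 in each step, so the iterates stay in a compact set, deterministically.

The QR retraction agrees with p + xi up to an error O(|xi|^2), uniformly in p and for all tangent
xi. Hence G(p_{t+1}) = G(p_t) - s_t |grad G(p_t)|^2 + D_t + O(s_t^2), where D_t is a martingale
difference of size O(1/t). No martingale convergence theorem is needed for sum D_t: by
orthogonality, the blocks of the sum between consecutive cubes are summable in mean, hence almost
surely, and inside a block the partial sums vary by O(1/j).

On the event that sum D_t converges, everything else is deterministic: G(p_t) converges, and
h_t = |grad G(p_t)|^2 satisfies sum s_t h_t < oo and |h_{t+1} - h_t| = O(s_t), so the increments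
of h_t^2 are absolutely summable and h_t tends to 0.
*)
theory Submission
  imports Defs
begin

section \<open>The QR retraction\<close>

text \<open>Conditional expectations are avoided by running the recursion on an arbitrary index
  sequence \<open>u\<close>. The iterate at time t then depends only on the coordinates of
  \<open>u\<close> below t, and a conditional mean given the past is a weighted sum over the
  finitely many values of coordinate t. All estimates hold for every \<open>u\<close>; randomness
  enters only through the convergence of sum D_t.

  The constants of a step depend on a compact set that must contain the iterates beforehand. The
  x-component breaks this circle: the retraction acts on it by plain addition, so its growth carries
  no retraction error. That growth is at most s_t^2 (16 alpha + 8 (2 + lambda^2) |x_t|^2), and Phi
  is large enough to make it at most 1 / (2 lambda (t + 1)^2) as long as |x_t|^2 is at most rho_0 +
  1 / lambda. Since sum 1 / (t + 1)^2 is at most 2, the latter bound reproduces itself.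

  The retraction estimate is uniform because of tangency: (X + Z)^T (X + Z) = I + Z^T Z has no
  linear term, so the triangular factor is I + O(|Z|^2) for Z of any size.\<close>

lemma inner_transpose: "transpose (A :: real^'n^'m) \<bullet> transpose B = A \<bullet> B"
  unfolding inner_vec_def transpose_def by (simp, rule sum.swap)

lemma inner_matrix_mult_left:
  fixes A :: "real^'l^'m" and B :: "real^'n^'l" and C :: "real^'n^'m"
  shows "(A ** B) \<bullet> C = B \<bullet> (transpose A ** C)"
proof -
  have "(A ** B) \<bullet> C = (\<Sum>i\<in>UNIV. \<Sum>j\<in>UNIV. \<Sum>l\<in>UNIV. A$i$l * B$l$j * C$i$j)"
    by (simp add: inner_vec_def matrix_matrix_mult_def sum_distrib_right)
  also have "\<dots> = (\<Sum>i\<in>UNIV. \<Sum>l\<in>UNIV. \<Sum>j\<in>UNIV. A$i$l * B$l$j * C$i$j)"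
    by (intro sum.cong refl sum.swap)
  also have "\<dots> = (\<Sum>l\<in>UNIV. \<Sum>i\<in>UNIV. \<Sum>j\<in>UNIV. A$i$l * B$l$j * C$i$j)"
    by (rule sum.swap)
  also have "\<dots> = (\<Sum>l\<in>UNIV. \<Sum>j\<in>UNIV. \<Sum>i\<in>UNIV. A$i$l * B$l$j * C$i$j)"
    by (intro sum.cong refl sum.swap)
  also have "\<dots> = B \<bullet> (transpose A ** C)"
    by (simp add: inner_vec_def matrix_matrix_mult_def transpose_def sum_distrib_left mult_ac)
  finally show ?thesis .
qed

lemma power2_norm_matrix:
  "(norm (A :: real^'n^'m))\<^sup>2 = (\<Sum>i\<in>UNIV. \<Sum>j\<in>UNIV. (A$i$j)\<^sup>2)"
  unfolding power2_norm_eq_inner by (simp add: inner_vec_def power2_eq_square)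

lemma column_le_norm_matrix:
  "(\<Sum>i\<in>UNIV. (A$i$j)\<^sup>2) \<le> (norm (A :: real^'n^'m))\<^sup>2"
  unfolding power2_norm_matrix by (intro sum_mono member_le_sum) auto

lemma norm_matrix_le_entries:
  fixes A :: "real^'n^'m"
  assumes "\<And>i j. \<bar>A$i$j\<bar> \<le> b"
  shows "norm A \<le> real CARD('m) * (real CARD('n) * b)"
proof -
  have "norm A \<le> (\<Sum>i\<in>UNIV. norm (A$i))"
    unfolding norm_vec_def by (rule L2_set_le_sum) simp
  also have "\<dots> \<le> (\<Sum>i\<in>(UNIV::'m set). \<Sum>j\<in>(UNIV::'n set). b)"
    by (intro sum_mono order_trans[OF norm_le_l1_cart] assms)
  finally show ?thesis by simp
qed

lemma norm_stiefel_mult: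
  assumes "(Q :: real^'k^'n) \<in> stiefel"
  shows "norm (Q ** B) = norm (B :: real^'l^'k)"
proof -
  have "(Q ** B) \<bullet> (Q ** B) = B \<bullet> B"
    using assms unfolding inner_matrix_mult_left stiefel_def
    by (simp add: matrix_mul_assoc)
  then show ?thesis by (simp add: norm_eq_sqrt_inner)
qed

text \<open>Used for two matrices with the same Gram matrix: the point \<open>X + Z\<close> before
  orthonormalisation and its triangular factor. Both are therefore injective and never shrink a
  vector. With \<open>Z = 0\<close> it covers the isometries, that is, Stiefel matrices.\<close>

lemma norm_mult_vec_gram:
  fixes C :: "real^'k^'n"
  assumes "transpose C ** C = mat 1 + transpose Z ** (Z :: real^'k^'l)"
  shows "(norm (C *v v))\<^sup>2 = (norm v)\<^sup>2 + (norm (Z *v v))\<^sup>2"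
proof -
  have *: "(norm (D *v v))\<^sup>2 = v \<bullet> ((transpose D ** D) *v v)" for D :: "real^'k^'o"
    by (metis power2_norm_eq_inner dot_lmul_matrix inner_commute matrix_vector_mul_assoc transpose_matrix_vector)
  show ?thesis
    unfolding *[of C] *[of Z] assms
    by (simp add: matrix_vector_mult_add_rdistrib inner_add_right power2_norm_eq_inner)
qed

lemma inj_mult_gram:
  fixes C :: "real^'k^'n"
  assumes "transpose C ** C = mat 1 + transpose Z ** (Z :: real^'k^'l)"
  assumes "C *v v = 0"
  shows "v = 0"
  using norm_mult_vec_gram[OF assms(1), of v] assms(2)
  by (simp add: add_nonneg_eq_0_iff)

lemma matrix_add_rdistrib: "(A + B) ** C = A ** C + B ** (C :: real^'n^'l)"
  by (simp add: matrix_matrix_mult_def vec_eq_iff distrib_right sum.distrib)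

text \<open>The two cross terms of the product add up to exactly the expression that vanishes on the
  tangent space.\<close>

lemma gram_add_tangent:
  assumes "X \<in> stiefel" "Z \<in> stiefel_tangent X"
  shows "transpose (X + Z) ** (X + Z) = mat 1 + transpose Z ** (Z :: real^'k^'n)"
proof -
  have [simp]: "transpose (X + Z) = transpose X + transpose Z"
    by (simp add: transpose_def vec_eq_iff)
  have "transpose (X + Z) ** (X + Z) =
      transpose X ** X + (transpose X ** Z + transpose Z ** X) + transpose Z ** Z"
    by (simp add: matrix_add_ldistrib matrix_add_rdistrib add_ac)
  then show ?thesis using assms by (simp add: stiefel_def stiefel_tangent_def)
qed

text \<open>Back substitution: at the largest index of \<open>S\<close> where \<open>v\<close> is
  nonzero, the row of \<open>T\<close> reduces to its diagonal term. Allowing any up-closed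
  \<open>S\<close> serves both injectivity (\<open>S = UNIV\<close>) and solutions of systems whose
  right-hand side vanishes beyond an index.\<close>

lemma upper_triangular_kernel:
  assumes "upper_triangular T" "\<And>i. 0 < T$i$i"
    and ker: "\<And>l. l \<in> S \<Longrightarrow> (T *v v)$l = 0"
    and up: "\<And>l r. l \<in> S \<Longrightarrow> l \<le> r \<Longrightarrow> r \<in> S" and "l \<in> S"
  shows "v$l = 0"
proof (rule ccontr)
  define N where "N = {l \<in> S. v$l \<noteq> 0}"
  assume "v$l \<noteq> 0"
  then have "N \<noteq> {}" using \<open>l \<in> S\<close> by (auto simp: N_def)
  then have M: "Max N \<in> N" by (intro Max_in) auto
  then have MS: "Max N \<in> S" by (simp add: N_def)
  have out: "v$r = 0" if "Max N < r" for r
  proof (rule ccontr)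
    assume "v$r \<noteq> 0"
    then have "r \<in> N" using up[OF MS, of r] that by (simp add: N_def)
    then show False using that by (meson finite leD Max_ge)
  qed
  have "(T *v v)$(Max N) = (\<Sum>r\<in>UNIV. T$(Max N)$r * v$r)"
    by (simp add: matrix_vector_mult_def)
  also have "\<dots> = (\<Sum>r\<in>UNIV. if r = Max N then T$r$r * v$r else 0)"
  proof (rule sum.cong)
    fix r show "T$(Max N)$r * v$r = (if r = Max N then T$r$r * v$r else 0)"
      using out[of r] assms(1) by (cases r "Max N" rule: linorder_cases) (auto simp: upper_triangular_def)
  qed simp
  finally have "(T *v v)$(Max N) = T$(Max N)$(Max N) * v$(Max N)" by simp
  then show False using assms(2)[of "Max N"] ker[of "Max N"] M by (simp add: N_def)
qed

text \<open>The gram condition forces every diagonal entry of \<open>T\<close> to be at least 1, while a column of \<open>T\<close>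
  has squared norm at most \<open>1 + \<parallel>Z\<parallel>\<^sup>2\<close>. So the off-diagonal entries are first \<open>O(\<parallel>Z\<parallel>)\<close>, and
  comparing the off-diagonal entries of both sides improves this to \<open>O(\<parallel>Z\<parallel>\<^sup>2)\<close>, with no smallness assumption on \<open>Z\<close>.\<close>
lemma cholesky_near_identity:
  fixes T :: "real^'k::{finite,linorder}^'k::{finite,linorder}" and Z :: "real^'k::{finite,linorder}^'n"
  assumes up: "upper_triangular T" and pos: "\<And>i. 0 < T$i$i"
    and gram: "transpose T ** T = mat 1 + transpose Z ** Z"
  shows "norm (T - mat 1) \<le> real CARD('k) * (real CARD('k) * ((real CARD('k) + 1) * (norm Z)\<^sup>2))"
proof -
  define e where "e = (norm Z)\<^sup>2"
  have e0: "0 \<le> e" by (simp add: e_def)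
  have entry: "(\<Sum>l\<in>UNIV. T$l$i * T$l$j) = (if i = j then 1 else 0) + (\<Sum>r\<in>UNIV. Z$r$i * Z$r$j)" for i j
    using arg_cong[OF gram, of "\<lambda>M. M$i$j"]
    by (simp add: matrix_matrix_mult_def transpose_def mat_def)
  \<comment> \<open>The preimage \<open>v\<close> of \<open>T$i$i\<close> times the i-th unit vector
    has no entries beyond \<open>i\<close>, so row \<open>i\<close> forces \<open>v$i = 1\<close>.
    As \<open>T\<close> does not shrink vectors, the norm \<open>T$i$i\<close> of the image is at
    least the norm of \<open>v\<close>, hence at least 1.\<close>
  have diag: "1 \<le> T$i$i" for i
  proof -
    have "inj ((*v) T)"
      using inj_mult_gram[OF gram] by (simp add: linear_injective_0)
    then have "surj ((*v) T)" by (simp add: linear_injective_imp_surjective)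
    then obtain v where v: "T *v v = T$i$i *\<^sub>R axis i 1" by (metis surjD)
    have above: "v$l = 0" if "i < l" for l
      by (rule upper_triangular_kernel[OF up pos, where S="{i<..}"]) (use v that in \<open>auto simp: axis_def\<close>)
    have "T$i$i = (T *v v)$i" by (simp add: v axis_def)
    also have "\<dots> = (\<Sum>r\<in>UNIV. T$i$r * v$r)"
      by (simp add: matrix_vector_mult_def)
    also have "\<dots> = (\<Sum>r\<in>UNIV. if r = i then T$i$i * v$i else 0)"
    proof (rule sum.cong)
      fix r show "T$i$r * v$r = (if r = i then T$i$i * v$i else 0)"
        using above[of r] up by (cases r i rule: linorder_cases) (auto simp: upper_triangular_def)
    qed simp
    finally have "v$i = 1" using pos[of i] by simp
    then have "1 \<le> (norm v)\<^sup>2" using component_le_norm_cart[of v i]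
      by (simp add: one_le_power)
    also have "\<dots> \<le> (norm (T *v v))\<^sup>2" by (simp add: norm_mult_vec_gram[OF gram])
    also have "\<dots> = (T$i$i)\<^sup>2" by (simp add: v norm_axis_1)
    finally show ?thesis using pos[of i] power2_le_imp_le[of 1 "T$i$i"] by simp
  qed
  have col: "(\<Sum>l\<in>UNIV-{j}. (T$l$j)\<^sup>2) + (T$j$j)\<^sup>2 \<le> 1 + e" for j
    using entry[of j j] column_le_norm_matrix[of Z j]
    by (simp add: e_def power2_eq_square sum.remove[of UNIV j] add.commute)
  have off1: "(T$l$j)\<^sup>2 \<le> e" if "l \<noteq> j" for l j
  proof -
    have "(T$l$j)\<^sup>2 \<le> (\<Sum>l\<in>UNIV-{j}. (T$l$j)\<^sup>2)" using that by (intro member_le_sum) auto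
    moreover have "1 \<le> (T$j$j)\<^sup>2" using diag[of j] by simp
    ultimately show ?thesis using col[of j] by linarith
  qed
  have diag1: "T$j$j - 1 \<le> e" for j
  proof -
    have "0 \<le> (\<Sum>l\<in>UNIV-{j}. (T$l$j)\<^sup>2)" by (intro sum_nonneg) auto
    moreover have "T$j$j * 1 \<le> T$j$j * T$j$j" using diag[of j] by (intro mult_left_mono) auto
    ultimately show ?thesis using col[of j] by (simp add: power2_eq_square)
  qed
  have young: "\<bar>a * b\<bar> \<le> (a\<^sup>2 + b\<^sup>2) / 2" for a b :: real
    using sum_squares_bound[of "\<bar>a\<bar>" "\<bar>b\<bar>"] by (simp add: abs_mult)
  \<comment> \<open>In the (i,j) entry of the Gram identity the term \<open>T$i$i * T$i$j\<close> is
    isolated. The terms with \<open>l > i\<close> vanish, those with \<open>l < i\<close> are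
    products of two off-diagonal entries, each O(|Z|), and dividing by \<open>T$i$i\<close> costs
    nothing since it is at least 1.\<close>
  have off: "\<bar>T$i$j\<bar> \<le> (real CARD('k) + 1) * e" if "i < j" for i j
  proof -
    have "\<bar>\<Sum>r\<in>UNIV. Z$r$i * Z$r$j\<bar> \<le> (\<Sum>r\<in>UNIV. ((Z$r$i)\<^sup>2 + (Z$r$j)\<^sup>2) / 2)"
      by (intro order_trans[OF sum_abs] sum_mono young)
    also have "\<dots> = ((\<Sum>r\<in>UNIV. (Z$r$i)\<^sup>2) + (\<Sum>r\<in>UNIV. (Z$r$j)\<^sup>2)) / 2"
      by (simp add: sum.distrib sum_divide_distrib[symmetric])
    also have "\<dots> \<le> e"
      using column_le_norm_matrix[of Z i] column_le_norm_matrix[of Z j] by (simp add: e_def)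
    finally have Zb: "\<bar>\<Sum>r\<in>UNIV. Z$r$i * Z$r$j\<bar> \<le> e" .
    have "\<bar>\<Sum>l\<in>UNIV-{i}. T$l$i * T$l$j\<bar> \<le> (\<Sum>l\<in>UNIV-{i}. e)"
    proof (intro order_trans[OF sum_abs] sum_mono)
      fix l assume "l \<in> UNIV - {i}"
      then consider "l < i" | "i < l" by force
      then show "\<bar>T$l$i * T$l$j\<bar> \<le> e"
      proof cases
        case 1
        then have "(T$l$i)\<^sup>2 \<le> e" "(T$l$j)\<^sup>2 \<le> e" using that by (auto intro!: off1)
        then show ?thesis by (intro order_trans[OF young]) simp
      next
        case 2 then show ?thesis using up e0 by (simp add: upper_triangular_def)
      qed
    qed
    also have "\<dots> \<le> real CARD('k) * e"
      using e0 by (simp add: mult_right_mono card_Diff_singleton)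
    finally have Tb: "\<bar>\<Sum>l\<in>UNIV-{i}. T$l$i * T$l$j\<bar> \<le> real CARD('k) * e" .
    have "T$i$i * T$i$j = (\<Sum>r\<in>UNIV. Z$r$i * Z$r$j) - (\<Sum>l\<in>UNIV-{i}. T$l$i * T$l$j)"
      using entry[of i j] less_imp_neq[OF that] by (simp add: sum.remove[of UNIV i] algebra_simps)
    then have "\<bar>T$i$i * T$i$j\<bar> \<le> e + real CARD('k) * e" using Zb Tb by linarith
    moreover have "1 * \<bar>T$i$j\<bar> \<le> \<bar>T$i$i\<bar> * \<bar>T$i$j\<bar>"
      using diag[of i] by (intro mult_right_mono) auto
    ultimately show ?thesis by (simp add: abs_mult algebra_simps)
  qed
  show ?thesis
  proof (rule norm_matrix_le_entries)
    fix i j :: 'k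
    consider "i < j" | "i = j" | "j < i" by force
    then show "\<bar>(T - mat 1)$i$j\<bar> \<le> (real CARD('k) + 1) * (norm Z)\<^sup>2"
    proof cases
      case 1 then show ?thesis using off[OF 1] less_imp_neq[OF 1] by (simp add: mat_def e_def)
    next
      case 2
      have "1 * e \<le> (real CARD('k) + 1) * e" using e0 by (intro mult_right_mono) auto
      then have "\<bar>T$i$i - 1\<bar> \<le> (real CARD('k) + 1) * e" using diag1[of i] diag[of i] by linarith
      then show ?thesis using 2 by (simp add: mat_def e_def)
    next
      case 3 then show ?thesis using up less_imp_neq[OF 3] by (simp add: mat_def upper_triangular_def)
    qed
  qed
qed

text \<open>Gram-Schmidt without recursion: each \<open>z j\<close> is obtained independently as the
  component of column \<open>j\<close> orthogonal to the span of the earlier columns, and normalised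
  to \<open>q j\<close>. Triangularity of \<open>T\<close> is then the orthogonality of
  \<open>q i\<close> to all columns before \<open>i\<close>.\<close>

lemma qr_exists:
  fixes C :: "real^'k::{finite,linorder}^'n"
  assumes inj: "\<And>v. C *v v = 0 \<Longrightarrow> v = 0"
  obtains Q T where "Q \<in> stiefel" "C = Q ** T" "upper_triangular T" "\<And>i. 0 < T$i$i"
proof -
  define c where "c j = column j C" for j
  have Csum: "C *v v = (\<Sum>j\<in>UNIV. v$j *\<^sub>R c j)" for v
    by (simp add: matrix_mult_sum c_def scalar_mult_eq_scaleR)
  have "\<exists>y z. y \<in> span (c ` {..<j}) \<and> (\<forall>w\<in>span (c ` {..<j}). orthogonal z w) \<and> c j = y + z" for j
    using orthogonal_subspace_decomp_exists[of "c ` {..<j}" "c j"] by metis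
  then obtain y z where y: "\<And>j. y j \<in> span (c ` {..<j})"
    and z: "\<And>j w. w \<in> span (c ` {..<j}) \<Longrightarrow> z j \<bullet> w = 0" and yz: "\<And>j. c j = y j + z j"
    unfolding orthogonal_def by metis
  \<comment> \<open>Otherwise column \<open>j\<close> is a combination of earlier columns; its
    coefficients, together with -1 at position \<open>j\<close>, form a nonzero kernel vector of
    \<open>C\<close>.\<close>
  have z0: "z j \<noteq> 0" for j
  proof
    assume "z j = 0"
    then have "c j \<in> span (c ` {..<j})" using y[of j] yz[of j] by simp
    moreover have "span (c ` {..<j}) \<subseteq> range (\<lambda>u. \<Sum>i<j. u i *\<^sub>R c i)"
    proof (rule span_minimal)
      show "c ` {..<j} \<subseteq> range (\<lambda>u. \<Sum>i<j. u i *\<^sub>R c i)"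
      proof clarify
        fix i assume "i < j"
        then show "c i \<in> range (\<lambda>u. \<Sum>i<j. u i *\<^sub>R c i)"
          by (intro range_eqI[of _ _ "\<lambda>l. if l = i then 1 else 0"])
            (simp add: if_distrib[of "\<lambda>a. a *\<^sub>R _"] cong: if_cong)
      qed
      show "subspace (range (\<lambda>u. \<Sum>i<j. u i *\<^sub>R c i))"
        unfolding subspace_def
      proof (intro conjI ballI allI)
        show "0 \<in> range (\<lambda>u. \<Sum>i<j. u i *\<^sub>R c i)" by (rule range_eqI[of _ _ "\<lambda>_. 0"]) simp
      next
        fix a b assume "a \<in> range (\<lambda>u. \<Sum>i<j. u i *\<^sub>R c i)" "b \<in> range (\<lambda>u. \<Sum>i<j. u i *\<^sub>R c i)"
        then obtain u w where "a = (\<Sum>i<j. u i *\<^sub>R c i)" "b = (\<Sum>i<j. w i *\<^sub>R c i)" by auto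
        then show "a + b \<in> range (\<lambda>u. \<Sum>i<j. u i *\<^sub>R c i)"
          by (intro range_eqI[of _ _ "\<lambda>i. u i + w i"]) (simp add: scaleR_add_left sum.distrib)
      next
        fix r a assume "a \<in> range (\<lambda>u. \<Sum>i<j. u i *\<^sub>R c i)"
        then obtain u where "a = (\<Sum>i<j. u i *\<^sub>R c i)" by auto
        then show "r *\<^sub>R a \<in> range (\<lambda>u. \<Sum>i<j. u i *\<^sub>R c i)"
          by (intro range_eqI[of _ _ "\<lambda>i. r * u i"]) (simp add: scaleR_sum_right)
      qed
    qed
    ultimately obtain u where u: "c j = (\<Sum>i<j. u i *\<^sub>R c i)" by auto
    define v :: "real^'k::{finite,linorder}" where "v = (\<chi> i. if i = j then -1 else if i < j then u i else 0)"
    have "C *v v = - c j + (\<Sum>i\<in>UNIV-{j}. v$i *\<^sub>R c i)"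
      unfolding Csum by (simp add: sum.remove[of UNIV j] v_def)
    also have "(\<Sum>i\<in>UNIV-{j}. v$i *\<^sub>R c i) = (\<Sum>i<j. u i *\<^sub>R c i)"
      by (rule sum.mono_neutral_cong_right) (auto simp: v_def)
    finally have "v = 0" using u inj by simp
    then have "v$j = 0" by simp
    then show False by (simp add: v_def)
  qed
  define q where "q j = (1 / norm (z j)) *\<^sub>R z j" for j
  have cmem: "c i \<in> span (c ` {..<j})" if "i < j" for i j using that by (intro span_base) auto
  have qspan: "q i \<in> span (c ` {..<j})" if "i < j" for i j
  proof -
    have "y i \<in> span (c ` {..<j})"
      using y[of i] span_mono[of "c ` {..<i}" "c ` {..<j}"] that by force
    then have "c i - y i \<in> span (c ` {..<j})" using cmem[OF that] by (intro span_diff)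
    then show ?thesis unfolding q_def using yz[of i] by (intro span_scale) simp
  qed
  have orth: "q j \<bullet> q i = (if i = j then 1 else 0)" for i j
  proof -
    have lt: "q j \<bullet> q i = 0" if "i < j" for i j
      using z[OF qspan[OF that]] by (auto simp: q_def)
    show ?thesis
    proof (cases i j rule: linorder_cases)
      case equal then show ?thesis using z0[of j] by (simp add: q_def dot_square_norm power2_eq_square)
    qed (use lt[of i j] lt[of j i] in \<open>auto simp: inner_commute\<close>)
  qed
  define Q :: "real^'k::{finite,linorder}^'n" where "Q = (\<chi> r i. q i $ r)"
  define T where "T = transpose Q ** C"
  have Tij: "T$i$j = q i \<bullet> c j" for i j
    by (simp add: T_def Q_def c_def column_def matrix_matrix_mult_def transpose_def inner_vec_def)
  have expand: "(\<Sum>i\<in>UNIV. (q i \<bullet> v) *\<^sub>R q i) = v" if "v \<in> span (range q)" for v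
    using that
  proof (induction rule: span_induct_alt)
    case base then show ?case by simp
  next
    case (step a x y)
    then obtain l where l: "x = q l" by auto
    have "(\<Sum>i\<in>UNIV. (q i \<bullet> (a *\<^sub>R x + y)) *\<^sub>R q i)
      = (\<Sum>i\<in>UNIV. (a * (if l = i then 1 else 0)) *\<^sub>R q i) + (\<Sum>i\<in>UNIV. (q i \<bullet> y) *\<^sub>R q i)"
      by (simp add: l inner_add_right orth scaleR_add_left sum.distrib)
    then show ?case using step by (simp add: l if_distrib if_distribR cong: if_cong)
  qed
  \<comment> \<open>Strong induction along the order of \<open>'k\<close>, measured by the number of
    predecessors, because \<open>y j\<close> lies in the span of the earlier columns.\<close>
  have cspan: "c j \<in> span (range q)" for j
  proof (induction "card {..<j}" arbitrary: j rule: less_induct)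
    case less
    have "c i \<in> span (range q)" if "i < j" for i
      using that by (intro less psubset_card_mono) auto
    then have "span (c ` {..<j}) \<subseteq> span (range q)" by (intro span_minimal) auto
    then have "y j \<in> span (range q)" using y by auto
    moreover have "z j \<in> span (range q)"
    proof -
      have "z j = norm (z j) *\<^sub>R q j" using z0[of j] by (simp add: q_def)
      then show ?thesis by (metis span_scale span_base rangeI)
    qed
    ultimately show ?case unfolding yz[of j] by (rule span_add)
  qed
  show ?thesis
  proof
    show "Q \<in> stiefel"
      unfolding stiefel_def using orth
      by (simp add: vec_eq_iff matrix_matrix_mult_def transpose_def mat_def Q_def inner_vec_def)
    show "C = Q ** T"
    proof (simp add: vec_eq_iff, intro allI)
      fix r j
      have "C$r$j = c j $ r" by (simp add: c_def column_def)
      also have "\<dots> = (\<Sum>i\<in>UNIV. (q i \<bullet> c j) *\<^sub>R q i) $ r" by (simp add: expand[OF cspan])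
      also have "\<dots> = (Q ** T)$r$j"
        by (simp add: matrix_matrix_mult_def Tij Q_def mult.commute)
      finally show "C$r$j = (Q ** T)$r$j" .
    qed
    show "upper_triangular T"
      unfolding upper_triangular_def Tij using z[OF cmem] by (simp add: q_def)
    show "0 < T$i$i" for i
    proof -
      have "z i \<bullet> c i = z i \<bullet> z i" using z[OF y] by (simp add: yz inner_add_right)
      then show ?thesis using z0[of i] by (simp add: Tij q_def)
    qed
  qed
qed

text \<open>Entry (i,j) of the Gram matrix of a triangular matrix involves only rows up to
  \<open>i\<close>, and row \<open>i\<close> enters as \<open>T$i$i * T$i$j\<close>. Once the
  earlier rows agree, \<open>j = i\<close> determines the positive diagonal entry and then every
  \<open>j\<close> the rest of the row.\<close>

lemma cholesky_unique:
  fixes S T :: "real^'k::{finite,linorder}^'k::{finite,linorder}"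
  assumes S: "upper_triangular S" "\<And>i. 0 < S$i$i"
    and T: "upper_triangular T" "\<And>i. 0 < T$i$i"
    and eq: "transpose S ** S = transpose T ** T"
  shows "S = T"
proof -
  have row: "\<forall>j. S$i$j = T$i$j" for i
  proof (induction "card {..<i}" arbitrary: i rule: less_induct)
    case less
    have IH: "S$l$j = T$l$j" if "l < i" for l j
      using that less psubset_card_mono[of "{..<i}" "{..<l}"] by force
    have split: "(transpose M ** M)$i$j = (\<Sum>l<i. M$l$i * M$l$j) + M$i$i * M$i$j"
      if "upper_triangular M" for M :: "real^'k::{finite,linorder}^'k::{finite,linorder}" and j
    proof -
      have "(transpose M ** M)$i$j = (\<Sum>l\<in>UNIV. M$l$i * M$l$j)"
        by (simp add: matrix_matrix_mult_def transpose_def)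
      also have "\<dots> = (\<Sum>l\<in>{..i}. M$l$i * M$l$j)"
        using that by (intro sum.mono_neutral_right) (auto simp: upper_triangular_def)
      also have "{..i} = insert i {..<i}" by auto
      finally show ?thesis by (simp add: add.commute)
    qed
    have eq': "S$i$i * S$i$j = T$i$i * T$i$j" for j
      using split[OF S(1), of j] split[OF T(1), of j] IH eq by simp
    have "S$i$i = T$i$i"
      using eq'[of i] S(2)[of i] T(2)[of i] by (metis less_le power2_eq_square power2_eq_imp_eq)
    then show ?case using eq' T(2)[of i] by (metis less_irrefl mult_cancel_left)
  qed
  then show ?thesis by (simp add: vec_eq_iff)
qed

lemma gram_stiefel_mult:
  assumes "(Q :: real^'k^'n) \<in> stiefel"
  shows "transpose (Q ** B) ** (Q ** B) = transpose B ** (B :: real^'l^'k)"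
proof -
  have "transpose (Q ** B) ** (Q ** B) = transpose B ** (transpose Q ** Q) ** B"
    by (simp add: matrix_transpose_mul matrix_mul_assoc)
  then show ?thesis using assms by (simp add: stiefel_def)
qed

text \<open>Any two admissible factorisations of \<open>C\<close> have triangular factors with the
  same Gram matrix, that of \<open>C\<close>. These factors coincide by Cholesky uniqueness and are
  invertible, so the orthonormal factors coincide too. This makes the \<open>THE\<close> in
  \<open>qf\<close> well defined.\<close>

lemma qf_eqI:
  fixes Q :: "real^'k::{finite,linorder}^'n"
  assumes Q: "Q \<in> stiefel" "C = Q ** T" "upper_triangular T" "\<And>i. 0 < T$i$i"
  shows "qf C = Q"
  unfolding qf_def
proof (rule the_equality)
  show "transpose Q ** Q = mat 1 \<and> (\<exists>T. C = Q ** T \<and> upper_triangular T \<and> (\<forall>i. 0 < T $ i $ i))"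
    using Q by (auto simp: stiefel_def)
next
  fix Q' :: "real^'k::{finite,linorder}^'n"
  assume "transpose Q' ** Q' = mat 1 \<and> (\<exists>T. C = Q' ** T \<and> upper_triangular T \<and> (\<forall>i. 0 < T $ i $ i))"
  then obtain T' where Q': "Q' \<in> stiefel" "C = Q' ** T'" "upper_triangular T'" "\<And>i. 0 < T'$i$i"
    by (auto simp: stiefel_def)
  have gram: "transpose T' ** T' = transpose T ** T"
    using gram_stiefel_mult[OF Q(1), of T] gram_stiefel_mult[OF Q'(1), of T'] Q(2) Q'(2) by simp
  have TT: "T' = T" by (rule cholesky_unique[OF Q'(3,4) Q(3,4) gram])
  have "v = 0" if "T *v v = 0" for v
    using upper_triangular_kernel[OF Q(3,4), of UNIV v] that by (simp add: vec_eq_iff)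
  then have "inj ((*v) T)" by (simp add: linear_injective_0)
  then obtain R where "T ** R = mat 1"
    by (metis matrix_left_invertible_injective matrix_left_right_inverse)
  then show "Q' = Q"
    using Q(2) Q'(2) TT by (metis matrix_mul_assoc matrix_mul_rid)
qed

text \<open>The error of the retraction is \<open>Q ** (mat 1 - T)\<close>, and left multiplication
  by \<open>Q\<close> preserves the Frobenius norm, so the question is only how far the Cholesky
  factor of I + Z^T Z is from the identity.\<close>

lemma
  fixes X :: "real^'k::{finite,linorder}^'n"
  assumes X: "X \<in> stiefel" and Z: "Z \<in> stiefel_tangent X"
  shows qf_in_stiefel: "qf (X + Z) \<in> stiefel"
    and qf_second_order: "norm (qf (X + Z) - (X + Z))
      \<le> real CARD('k) * (real CARD('k) * ((real CARD('k) + 1) * (norm Z)\<^sup>2))"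
proof -
  note gram = gram_add_tangent[OF X Z]
  obtain Q T where QT: "Q \<in> stiefel" "X + Z = Q ** T" "upper_triangular T" "\<And>i. 0 < T$i$i"
    using qr_exists inj_mult_gram[OF gram] by metis
  have qf: "qf (X + Z) = Q" by (rule qf_eqI[OF QT])
  then show "qf (X + Z) \<in> stiefel" by (simp add: QT)
  have "transpose T ** T = mat 1 + transpose Z ** Z"
    using gram_stiefel_mult[OF QT(1), of T] gram QT(2) by simp
  note near = cholesky_near_identity[OF QT(3,4) this]
  have "Q ** mat 1 = Q ** (mat 1 - T) + Q ** T"
    by (simp flip: matrix_add_ldistrib)
  then have "qf (X + Z) - (X + Z) = Q ** (mat 1 - T)"
    unfolding qf unfolding QT(2) by (simp add: algebra_simps)
  then have "norm (qf (X + Z) - (X + Z)) = norm (T - mat 1)"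
    by (simp add: norm_stiefel_mult[OF QT(1)] norm_minus_commute)
  then show "norm (qf (X + Z) - (X + Z))
      \<le> real CARD('k) * (real CARD('k) * ((real CARD('k) + 1) * (norm Z)\<^sup>2))"
    using near by simp
qed

section \<open>Riemannian gradients\<close>

text \<open>For \<open>X\<close> in the Stiefel manifold this is the orthogonal projection Z - X
  sym(X^T Z) onto the tangent space at \<open>X\<close>.\<close>

definition stiefel_proj :: "real^'k^'n \<Rightarrow> real^'k^'n \<Rightarrow> real^'k^'n" where
  "stiefel_proj X Z = Z - (1/2) *\<^sub>R (X ** (transpose X ** Z + transpose Z ** X))"

definition tangent_proj :: "('m::finite, 'n::finite, 'k::finite) triple \<Rightarrow> ('m, 'n, 'k) triple \<Rightarrow> ('m, 'n, 'k) triple" where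
  "tangent_proj = (\<lambda>(U, x, V) (Y, y, Z). (stiefel_proj U Y, y, stiefel_proj V Z))"

lemma transpose_add: "transpose (A + B) = transpose A + transpose (B :: 'a::ab_group_add^'n^'m)"
  by (simp add: transpose_def vec_eq_iff)

lemma transpose_diff: "transpose (A - B) = transpose A - transpose (B :: 'a::ab_group_add^'n^'m)"
  by (simp add: transpose_def vec_eq_iff)

lemma transpose_scaleR: "transpose (c *\<^sub>R A) = c *\<^sub>R transpose (A :: real^'n^'m)"
  by (simp add: transpose_def vec_eq_iff)

lemma matrix_scaleR_left: "(c *\<^sub>R A) ** B = c *\<^sub>R (A ** (B :: real^'n^'l))"
  by (simp add: matrix_matrix_mult_def vec_eq_iff sum_distrib_left mult_ac)

lemma matrix_scaleR_right: "A ** (c *\<^sub>R B) = c *\<^sub>R (A ** (B :: real^'n^'l))"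
  by (simp add: matrix_matrix_mult_def vec_eq_iff sum_distrib_left mult_ac)

lemma matrix_diff_ldistrib: "A ** (B - C) = A ** B - A ** (C :: real^'n^'l)"
  by (simp add: matrix_matrix_mult_def vec_eq_iff sum_subtractf right_diff_distrib)

lemma matrix_diff_rdistrib: "(A - B) ** C = A ** C - B ** (C :: real^'n^'l)"
  by (simp add: matrix_matrix_mult_def vec_eq_iff sum_subtractf left_diff_distrib)

lemma subspace_stiefel_tangent: "subspace (stiefel_tangent X)"
proof -
  have "transpose X ** (a + b) + transpose (a + b) ** X
    = (transpose X ** a + transpose a ** X) + (transpose X ** b + transpose b ** X)" for a b
    by (simp add: transpose_add matrix_add_ldistrib matrix_add_rdistrib)
  moreover have "transpose X ** (c *\<^sub>R a) + transpose (c *\<^sub>R a) ** X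
    = c *\<^sub>R (transpose X ** a + transpose a ** X)" for a c
    by (simp add: transpose_scaleR matrix_scaleR_left matrix_scaleR_right scaleR_add_right)
  moreover have "transpose X ** 0 + transpose 0 ** X = 0"
    by (simp add: matrix_matrix_mult_def vec_eq_iff transpose_def)
  ultimately show ?thesis unfolding subspace_def stiefel_tangent_def by simp
qed

lemma subspace_tangent_M: "subspace (tangent_M p)"
  unfolding tangent_M_def by (cases p) (simp add: subspace_Times subspace_stiefel_tangent)

lemma stiefel_proj_in_tangent:
  assumes "X \<in> stiefel"
  shows "stiefel_proj X Z \<in> stiefel_tangent X"
proof -
  define M where "M = transpose X ** Z + transpose Z ** X"
  have M: "transpose M = M"
    by (simp add: M_def transpose_add matrix_transpose_mul add.commute)
  have X: "transpose X ** X = mat 1" using assms by (simp add: stiefel_def)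
  have 1: "transpose X ** stiefel_proj X Z = transpose X ** Z - (1/2) *\<^sub>R M"
    unfolding stiefel_proj_def M_def[symmetric]
    by (simp add: matrix_diff_ldistrib matrix_scaleR_right matrix_mul_assoc X)
  have 2: "transpose (stiefel_proj X Z) ** X = transpose Z ** X - (1/2) *\<^sub>R M"
    unfolding stiefel_proj_def M_def[symmetric]
    by (simp add: transpose_diff transpose_scaleR matrix_transpose_mul M matrix_diff_rdistrib
        matrix_scaleR_left X flip: matrix_mul_assoc)
  have "transpose X ** stiefel_proj X Z + transpose (stiefel_proj X Z) ** X
      = M - ((1/2) *\<^sub>R M + (1/2) *\<^sub>R M)"
    unfolding 1 2 by (simp add: M_def algebra_simps)
  then show ?thesis by (simp add: stiefel_tangent_def flip: scaleR_add_left)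
qed

text \<open>The subtracted term pairs with \<open>Y\<close> as a symmetric matrix against X^T Y,
  which is antisymmetric for tangent \<open>Y\<close>.\<close>

lemma inner_stiefel_proj:
  assumes "Y \<in> stiefel_tangent X"
  shows "stiefel_proj X Z \<bullet> Y = Z \<bullet> Y"
proof -
  define M where "M = transpose X ** Z + transpose Z ** X"
  have M: "transpose M = M"
    by (simp add: M_def transpose_add matrix_transpose_mul add.commute)
  define N where "N = transpose X ** Y"
  have "transpose N = - N"
    using assms by (simp add: N_def matrix_transpose_mul stiefel_tangent_def eq_neg_iff_add_eq_0 add.commute)
  then have "M \<bullet> N = - (M \<bullet> N)" using inner_transpose[of M N] M by simp
  then have "(X ** M) \<bullet> Y = 0" by (simp add: inner_matrix_mult_left N_def)
  then show ?thesis by (simp add: stiefel_proj_def M_def inner_diff_left)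
qed

lemma tangent_proj_in_tangent: "p \<in> manifold_M \<Longrightarrow> tangent_proj p g \<in> tangent_M p"
  by (auto simp: tangent_proj_def tangent_M_def manifold_M_def stiefel_proj_in_tangent split: prod.splits)

lemma inner_tangent_proj: "\<xi> \<in> tangent_M p \<Longrightarrow> tangent_proj p g \<bullet> \<xi> = g \<bullet> \<xi>"
  by (auto simp: tangent_proj_def tangent_M_def inner_stiefel_proj split: prod.splits)

lemma linear_stiefel_proj: "linear (stiefel_proj X)"
  by (rule linearI)
    (simp_all add: stiefel_proj_def transpose_add transpose_scaleR matrix_add_ldistrib
      matrix_add_rdistrib matrix_scaleR_left matrix_scaleR_right algebra_simps)

lemma linear_tangent_proj: "linear (tangent_proj p)"
  by (rule linearI)
    (auto simp: tangent_proj_def linear_add[OF linear_stiefel_proj]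
      linear_scale[OF linear_stiefel_proj] split: prod.splits)

lemma
  fixes p \<xi> :: "('m::finite, 'n::finite, 'k::{finite,linorder}) triple"
  assumes "p \<in> manifold_M" "\<xi> \<in> tangent_M p"
  shows retraction_in_manifold: "retraction_M p \<xi> \<in> manifold_M"
    and retraction_second_order: "norm (retraction_M p \<xi> - (p + \<xi>))
      \<le> 2 * (real CARD('k) * (real CARD('k) * (real CARD('k) + 1))) * (norm \<xi>)\<^sup>2"
proof -
  obtain U x V Y y Z where p: "p = (U, x, V)" and xi: "\<xi> = (Y, y, Z)" by (metis prod.collapse)
  define K where "K = real CARD('k) * (real CARD('k) * (real CARD('k) + 1))"
  have K0: "0 \<le> K" by (simp add: K_def)
  have U: "U \<in> stiefel" "Y \<in> stiefel_tangent U" and V: "V \<in> stiefel" "Z \<in> stiefel_tangent V"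
    using assms by (auto simp: p xi manifold_M_def tangent_M_def)
  show "retraction_M p \<xi> \<in> manifold_M"
    using qf_in_stiefel[OF U] qf_in_stiefel[OF V]
    by (simp add: p xi retraction_M_def manifold_M_def)
  have nY: "norm Y \<le> norm \<xi>" unfolding xi by (rule norm_fst_le)
  have nZ: "norm Z \<le> norm \<xi>" unfolding xi by (rule order_trans[OF norm_snd_le norm_snd_le])
  have "norm (retraction_M p \<xi> - (p + \<xi>))
      \<le> norm (qf (U + Y) - (U + Y)) + (norm (0 :: real^'k::{finite,linorder}) + norm (qf (V + Z) - (V + Z)))"
    by (simp add: p xi retraction_M_def) (intro order_trans[OF norm_Pair_le] add_left_mono, simp)
  also have "\<dots> \<le> K * (norm Y)\<^sup>2 + K * (norm Z)\<^sup>2"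
    using qf_second_order[OF U] qf_second_order[OF V] by (simp add: K_def mult.assoc)
  also have "\<dots> \<le> K * (norm \<xi>)\<^sup>2 + K * (norm \<xi>)\<^sup>2"
    using nY nZ K0 by (intro add_mono mult_left_mono power_mono) auto
  finally show "norm (retraction_M p \<xi> - (p + \<xi>))
      \<le> 2 * (real CARD('k) * (real CARD('k) * (real CARD('k) + 1))) * (norm \<xi>)\<^sup>2"
    by (simp add: K_def)
qed

text \<open>Needed for the uniqueness half of \<open>riem_grad\<close>: its condition says something
  about a tangent vector only if some curve realises that vector. The retraction supplies the curve,
  and its second-order bound gives the velocity.\<close>

lemma exists_curve:
  fixes p \<xi> :: "('m::finite, 'n::finite, 'k::{finite,linorder}) triple"
  assumes p: "p \<in> manifold_M" and xi: "\<xi> \<in> tangent_M p"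
  obtains c where "\<And>t. c t \<in> manifold_M" "c 0 = p" "(c has_vector_derivative \<xi>) (at 0)"
proof
  define K where "K = 2 * (real CARD('k) * (real CARD('k) * (real CARD('k) + 1)))"
  define c where "c t = retraction_M p (t *\<^sub>R \<xi>)" for t
  have txi: "t *\<^sub>R \<xi> \<in> tangent_M p" for t
    using xi subspace_tangent_M by (metis subspace_scale)
  show "c t \<in> manifold_M" for t
    unfolding c_def by (intro retraction_in_manifold p txi)
  have est: "norm (c t - p - t *\<^sub>R \<xi>) \<le> K * (norm \<xi>)\<^sup>2 * t\<^sup>2" for t
    using retraction_second_order[OF p txi[of t]]
    by (simp add: c_def K_def power_mult_distrib mult_ac diff_diff_eq)
  show c0: "c 0 = p" using est[of 0] by simp
  have "((\<lambda>t. (c t - p - t *\<^sub>R \<xi>) /\<^sub>R \<bar>t\<bar>) \<longlongrightarrow> 0) (at 0)"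
  proof (rule Lim_null_comparison)
    show "\<forall>\<^sub>F t in at 0. norm ((c t - p - t *\<^sub>R \<xi>) /\<^sub>R \<bar>t\<bar>) \<le> K * (norm \<xi>)\<^sup>2 * \<bar>t\<bar>"
    proof (intro always_eventually allI)
      fix t :: real
      have "norm (c t - p - t *\<^sub>R \<xi>) / \<bar>t\<bar> \<le> K * (norm \<xi>)\<^sup>2 * t\<^sup>2 / \<bar>t\<bar>"
        by (intro divide_right_mono est) simp
      also have "\<dots> = K * (norm \<xi>)\<^sup>2 * \<bar>t\<bar>"
        by (cases "t = 0") (auto simp: field_simps power2_eq_square abs_mult_self_eq)
      finally show "norm ((c t - p - t *\<^sub>R \<xi>) /\<^sub>R \<bar>t\<bar>) \<le> K * (norm \<xi>)\<^sup>2 * \<bar>t\<bar>"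
        by (simp add: divide_inverse mult.commute)
    qed
    have "((\<lambda>t::real. K * (norm \<xi>)\<^sup>2 * \<bar>t\<bar>) \<longlongrightarrow> K * (norm \<xi>)\<^sup>2 * \<bar>0\<bar>) (at 0)"
      by (intro tendsto_intros)
    then show "((\<lambda>t::real. K * (norm \<xi>)\<^sup>2 * \<bar>t\<bar>) \<longlongrightarrow> 0) (at 0)" by simp
  qed
  then show "(c has_vector_derivative \<xi>) (at 0)"
    unfolding has_vector_derivative_def has_derivative_at_within
    by (simp add: c0 bounded_linear_scaleR_left algebra_simps)
qed

text \<open>Along any curve with velocity \<open>\<xi>\<close> the chain rule gives the slope
  \<open>g \<bullet> \<xi>\<close>, and the tangential part of \<open>g\<close> has the same inner
  product with tangent vectors.\<close>

lemma riem_grad_eq_tangent_proj: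
  fixes p :: "('m::finite, 'n::finite, 'k::{finite,linorder}) triple"
  assumes p: "p \<in> manifold_M" and f: "(f has_derivative (\<lambda>h. g \<bullet> h)) (at p)"
  shows "riem_grad f p = tangent_proj p g"
  unfolding riem_grad_def
proof (rule the_equality)
  have chain: "((\<lambda>t. f (c t)) has_real_derivative (g \<bullet> \<xi>)) (at 0)"
    if "c 0 = p" "(c has_vector_derivative \<xi>) (at 0)" for c \<xi>
  proof -
    have "((f \<circ> c) has_derivative (\<lambda>h. g \<bullet> h) \<circ> (\<lambda>x. x *\<^sub>R \<xi>)) (at 0)"
      using that f by (intro diff_chain_at) (auto simp: has_vector_derivative_def)
    then show ?thesis by (simp add: has_field_derivative_def o_def mult_commute_abs)
  qed
  then show "tangent_proj p g \<in> tangent_M p \<and> (\<forall>\<xi>\<in>tangent_M p. \<forall>c.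
      (\<forall>t. c t \<in> manifold_M) \<and> c 0 = p \<and> (c has_vector_derivative \<xi>) (at 0) \<longrightarrow>
      ((\<lambda>t. f (c t)) has_real_derivative tangent_proj p g \<bullet> \<xi>) (at 0))"
    using tangent_proj_in_tangent[OF p] inner_tangent_proj by metis
  fix z
  assume z: "z \<in> tangent_M p \<and> (\<forall>\<xi>\<in>tangent_M p. \<forall>c.
      (\<forall>t. c t \<in> manifold_M) \<and> c 0 = p \<and> (c has_vector_derivative \<xi>) (at 0) \<longrightarrow>
      ((\<lambda>t. f (c t)) has_real_derivative z \<bullet> \<xi>) (at 0))"
  \<comment> \<open>Testing a competitor \<open>z\<close> along a curve in the direction of its own
    deviation makes the squared norm of that deviation zero.\<close>
  define \<xi> where "\<xi> = z - tangent_proj p g"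
  have xi: "\<xi> \<in> tangent_M p"
    unfolding \<xi>_def using z tangent_proj_in_tangent[OF p] by (intro subspace_diff subspace_tangent_M) auto
  obtain c where c: "\<And>t. c t \<in> manifold_M" "c 0 = p" "(c has_vector_derivative \<xi>) (at 0)"
    using exists_curve[OF p xi] by metis
  have "z \<bullet> \<xi> = g \<bullet> \<xi>" using z xi c chain[OF c(2,3)] DERIV_unique by blast
  then have "\<xi> \<bullet> \<xi> = 0" using inner_tangent_proj[OF xi, of g] by (simp add: \<xi>_def inner_diff_left)
  then show "z = tangent_proj p g" by (simp add: \<xi>_def)
qed

section \<open>Functions that are Lipschitz on balls\<close>

text \<open>The gradients and projections that occur are polynomial in the matrix entries. Unlike
  global Lipschitz maps, this class is closed under products, so bounds, Lipschitz constants and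
  continuity of all of them follow from closure rules.\<close>

definition lip_on_balls :: "('a::real_normed_vector \<Rightarrow> 'b::real_normed_vector) \<Rightarrow> bool" where
  "lip_on_balls f \<longleftrightarrow>
    (\<forall>B. \<exists>L\<ge>0. \<forall>x y. norm x \<le> B \<longrightarrow> norm y \<le> B \<longrightarrow> norm (f x - f y) \<le> L * norm (x - y))"

lemma lip_on_ballsE:
  assumes "lip_on_balls f"
  obtains L where "0 \<le> L" "\<And>x y. norm x \<le> B \<Longrightarrow> norm y \<le> B \<Longrightarrow> norm (f x - f y) \<le> L * norm (x - y)"
  using assms unfolding lip_on_balls_def by metis

lemma lip_on_balls_bounded:
  assumes "lip_on_balls f"
  obtains M where "0 \<le> M" "\<And>x. norm x \<le> B \<Longrightarrow> norm (f x) \<le> M"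
proof -
  \<comment> \<open>Passing to |B| guarantees that the reference point 0 lies in the ball, even for
    negative \<open>B\<close>.\<close>
  obtain L where L: "0 \<le> L" "\<And>x y. norm x \<le> \<bar>B\<bar> \<Longrightarrow> norm y \<le> \<bar>B\<bar> \<Longrightarrow> norm (f x - f y) \<le> L * norm (x - y)"
    using lip_on_ballsE[OF assms, where B = "\<bar>B\<bar>"] by metis
  show ?thesis
  proof
    show "0 \<le> L * \<bar>B\<bar> + norm (f 0)" using L(1) by simp
    fix x :: 'a assume "norm x \<le> B"
    then have x: "norm x \<le> \<bar>B\<bar>" by simp
    then have "L * norm x \<le> L * \<bar>B\<bar>" by (intro mult_left_mono L(1))
    then show "norm (f x) \<le> L * \<bar>B\<bar> + norm (f 0)"
      using L(2)[OF x, of 0] norm_triangle_sub[of "f x" "f 0"] by simp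
  qed
qed

lemma lip_on_balls_compose_linear:
  assumes "bounded_linear h" "lip_on_balls f"
  shows "lip_on_balls (\<lambda>x. h (f x))"
  unfolding lip_on_balls_def
proof
  fix B
  obtain K where K: "0 \<le> K" "\<And>x. norm (h x) \<le> norm x * K"
    using bounded_linear.nonneg_bounded[OF assms(1)] by blast
  obtain L where L: "0 \<le> L" "\<And>x y. norm x \<le> B \<Longrightarrow> norm y \<le> B \<Longrightarrow> norm (f x - f y) \<le> L * norm (x - y)"
    using lip_on_ballsE[OF assms(2), where B = B] by metis
  have "norm (h (f x) - h (f y)) \<le> K * L * norm (x - y)" if "norm x \<le> B" "norm y \<le> B" for x y
  proof -
    have "norm (h (f x) - h (f y)) \<le> norm (f x - f y) * K"
      using K(2) by (simp flip: linear_diff[OF bounded_linear.linear[OF assms(1)]])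
    also have "\<dots> \<le> (L * norm (x - y)) * K" using L(2)[OF that] K(1) by (rule mult_right_mono)
    finally show ?thesis by (simp add: mult_ac)
  qed
  then show "\<exists>L\<ge>0. \<forall>x y. norm x \<le> B \<longrightarrow> norm y \<le> B \<longrightarrow> norm (h (f x) - h (f y)) \<le> L * norm (x - y)"
    using K(1) L(1) by (intro exI[of _ "K * L"]) simp
qed

lemma lip_on_balls_const [simp, intro]: "lip_on_balls (\<lambda>x. c)"
  unfolding lip_on_balls_def by (auto intro: exI[of _ 0])

lemma lip_on_balls_id [simp, intro]: "lip_on_balls (\<lambda>x. x)"
  unfolding lip_on_balls_def by (auto intro: exI[of _ 1])

lemma lip_on_balls_fst: "lip_on_balls f \<Longrightarrow> lip_on_balls (\<lambda>x. fst (f x))"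
  by (rule lip_on_balls_compose_linear[OF bounded_linear_fst])

lemma lip_on_balls_snd: "lip_on_balls f \<Longrightarrow> lip_on_balls (\<lambda>x. snd (f x))"
  by (rule lip_on_balls_compose_linear[OF bounded_linear_snd])

lemma lip_on_balls_vec_nth: "lip_on_balls f \<Longrightarrow> lip_on_balls (\<lambda>x. f x $ i)"
  by (rule lip_on_balls_compose_linear[OF bounded_linear_vec_nth])

lemma lip_on_balls_add:
  assumes "lip_on_balls f" "lip_on_balls g"
  shows "lip_on_balls (\<lambda>x. f x + g x)"
  unfolding lip_on_balls_def
proof
  fix B
  obtain L where L: "0 \<le> L" "\<And>x y. norm x \<le> B \<Longrightarrow> norm y \<le> B \<Longrightarrow> norm (f x - f y) \<le> L * norm (x - y)"
    using lip_on_ballsE[OF assms(1), where B = B] by metis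
  obtain M where M: "0 \<le> M" "\<And>x y. norm x \<le> B \<Longrightarrow> norm y \<le> B \<Longrightarrow> norm (g x - g y) \<le> M * norm (x - y)"
    using lip_on_ballsE[OF assms(2), where B = B] by metis
  have "norm (f x + g x - (f y + g y)) \<le> (L + M) * norm (x - y)" if "norm x \<le> B" "norm y \<le> B" for x y
    using norm_diff_triangle_ineq[of "f x" "g x" "f y" "g y"] L(2)[OF that] M(2)[OF that]
    by (simp add: distrib_right)
  then show "\<exists>L\<ge>0. \<forall>x y. norm x \<le> B \<longrightarrow> norm y \<le> B \<longrightarrow> norm (f x + g x - (f y + g y)) \<le> L * norm (x - y)"
    using L(1) M(1) by (intro exI[of _ "L + M"]) simp
qed

lemma lip_on_balls_scaleR:
  fixes f :: "'a::real_normed_vector \<Rightarrow> real" and g :: "'a \<Rightarrow> 'b::real_normed_vector"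
  assumes "lip_on_balls f" "lip_on_balls g"
  shows "lip_on_balls (\<lambda>x. f x *\<^sub>R g x)"
  unfolding lip_on_balls_def
proof
  fix B
  obtain L where L: "0 \<le> L" "\<And>x y. norm x \<le> B \<Longrightarrow> norm y \<le> B \<Longrightarrow> norm (f x - f y) \<le> L * norm (x - y)"
    using lip_on_ballsE[OF assms(1), where B = B] by metis
  obtain M where M: "0 \<le> M" "\<And>x y. norm x \<le> B \<Longrightarrow> norm y \<le> B \<Longrightarrow> norm (g x - g y) \<le> M * norm (x - y)"
    using lip_on_ballsE[OF assms(2), where B = B] by metis
  obtain F where F: "0 \<le> F" "\<And>x. norm x \<le> B \<Longrightarrow> norm (f x) \<le> F"
    using lip_on_balls_bounded[OF assms(1), where B = B] by metis
  obtain G where G: "0 \<le> G" "\<And>x. norm x \<le> B \<Longrightarrow> norm (g x) \<le> G"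
    using lip_on_balls_bounded[OF assms(2), where B = B] by metis
  have "norm (f x *\<^sub>R g x - f y *\<^sub>R g y) \<le> (F * M + L * G) * norm (x - y)"
    if xy: "norm x \<le> B" "norm y \<le> B" for x y
  proof -
    have "f x *\<^sub>R g x - f y *\<^sub>R g y = f x *\<^sub>R (g x - g y) + (f x - f y) *\<^sub>R g y"
      by (simp add: algebra_simps)
    then have "norm (f x *\<^sub>R g x - f y *\<^sub>R g y) \<le> norm (f x) * norm (g x - g y) + norm (f x - f y) * norm (g y)"
      using norm_triangle_ineq[of "f x *\<^sub>R (g x - g y)" "(f x - f y) *\<^sub>R g y"] by simp
    also have "\<dots> \<le> F * (M * norm (x - y)) + (L * norm (x - y)) * G"
      using xy F L G M by (intro add_mono mult_mono) auto
    finally show ?thesis by (simp add: algebra_simps)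
  qed
  then show "\<exists>L\<ge>0. \<forall>x y. norm x \<le> B \<longrightarrow> norm y \<le> B \<longrightarrow> norm (f x *\<^sub>R g x - f y *\<^sub>R g y) \<le> L * norm (x - y)"
    using L(1) M(1) F(1) G(1) by (intro exI[of _ "F * M + L * G"]) simp
qed

lemmas lip_on_balls_mult = lip_on_balls_scaleR[where 'b = real, unfolded real_scaleR_def]

lemma lip_on_balls_diff:
  assumes "lip_on_balls f" "lip_on_balls g"
  shows "lip_on_balls (\<lambda>x. f x - g x)"
  using lip_on_balls_add[OF assms(1) lip_on_balls_scaleR[OF lip_on_balls_const assms(2), of "-1"]] by simp

lemma lip_on_balls_sum:
  assumes "\<And>i. i \<in> I \<Longrightarrow> lip_on_balls (f i)"
  shows "lip_on_balls (\<lambda>x. \<Sum>i\<in>I. f i x)"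
  using assms by (induction I rule: infinite_finite_induct) (auto intro: lip_on_balls_add)

lemma lip_on_balls_vec:
  fixes f :: "'a::real_normed_vector \<Rightarrow> 'b::real_normed_vector ^ 'n"
  assumes "\<And>i. lip_on_balls (\<lambda>x. f x $ i)"
  shows "lip_on_balls f"
  unfolding lip_on_balls_def
proof
  fix B
  have "\<forall>i. \<exists>L\<ge>0. \<forall>x y. norm x \<le> B \<longrightarrow> norm y \<le> B \<longrightarrow> norm (f x $ i - f y $ i) \<le> L * norm (x - y)"
    using assms by (simp add: lip_on_balls_def)
  then obtain L where L: "\<And>i. 0 \<le> L i"
    "\<And>i x y. norm x \<le> B \<Longrightarrow> norm y \<le> B \<Longrightarrow> norm (f x $ i - f y $ i) \<le> L i * norm (x - y)"
    by metis
  have "norm (f x - f y) \<le> (\<Sum>i\<in>UNIV. L i) * norm (x - y)" if "norm x \<le> B" "norm y \<le> B" for x y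
  proof -
    have "norm (f x - f y) \<le> (\<Sum>i\<in>UNIV. norm ((f x - f y) $ i))"
      unfolding norm_vec_def by (rule L2_set_le_sum) simp
    also have "\<dots> \<le> (\<Sum>i\<in>UNIV. L i * norm (x - y))"
      using L(2)[OF that] by (intro sum_mono) simp
    finally show ?thesis by (simp add: sum_distrib_right)
  qed
  then show "\<exists>L\<ge>0. \<forall>x y. norm x \<le> B \<longrightarrow> norm y \<le> B \<longrightarrow> norm (f x - f y) \<le> L * norm (x - y)"
    using L(1) by (intro exI[of _ "\<Sum>i\<in>UNIV. L i"]) (simp add: sum_nonneg)
qed

lemma lip_on_balls_Pair:
  fixes f :: "'a::real_normed_vector \<Rightarrow> 'b::real_normed_vector"
    and g :: "'a \<Rightarrow> 'c::real_normed_vector"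
  assumes "lip_on_balls f" "lip_on_balls g"
  shows "lip_on_balls (\<lambda>x. (f x, g x))"
proof -
  have "bounded_linear (\<lambda>a :: 'b. (a, 0 :: 'c))" "bounded_linear (\<lambda>b :: 'c. (0 :: 'b, b))"
    by (intro bounded_linear_Pair bounded_linear_ident bounded_linear_zero)+
  then have "lip_on_balls (\<lambda>x. (f x, 0 :: 'c))" "lip_on_balls (\<lambda>x. (0 :: 'b, g x))"
    using assms lip_on_balls_compose_linear by blast+
  then have "lip_on_balls (\<lambda>x. (f x, 0) + (0, g x))" by (rule lip_on_balls_add)
  then show ?thesis by simp
qed

lemmas lip_on_balls_intros = lip_on_balls_const lip_on_balls_id lip_on_balls_fst lip_on_balls_snd
  lip_on_balls_vec_nth lip_on_balls_add lip_on_balls_diff lip_on_balls_mult lip_on_balls_scaleR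
  lip_on_balls_sum lip_on_balls_Pair

lemma lip_on_balls_matrix_mult:
  fixes f :: "'a::real_normed_vector \<Rightarrow> real^'l^'m" and g :: "'a \<Rightarrow> real^'n^'l"
  assumes "lip_on_balls f" "lip_on_balls g"
  shows "lip_on_balls (\<lambda>x. f x ** g x)"
  by (intro lip_on_balls_vec) (auto simp: matrix_matrix_mult_def intro!: lip_on_balls_intros assms)

lemma lip_on_balls_transpose:
  fixes f :: "'a::real_normed_vector \<Rightarrow> real^'l^'m"
  assumes "lip_on_balls f"
  shows "lip_on_balls (\<lambda>x. transpose (f x))"
  by (intro lip_on_balls_vec) (auto simp: transpose_def intro!: lip_on_balls_intros assms)

lemma lip_on_balls_tangent_proj:
  fixes g :: "('m::finite, 'n::finite, 'k::finite) triple \<Rightarrow> ('m, 'n, 'k) triple"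
  assumes "lip_on_balls g"
  shows "lip_on_balls (\<lambda>p. tangent_proj p (g p))"
  unfolding tangent_proj_def stiefel_proj_def case_prod_beta
  by (intro lip_on_balls_intros lip_on_balls_matrix_mult lip_on_balls_transpose assms)

text \<open>The mean value theorem on the segment from \<open>p\<close> to \<open>q\<close>, which
  stays in the ball by convexity. Evaluating \<open>g\<close> at an intermediate point instead of
  integrating gives the constant \<open>L\<close> rather than \<open>L / 2\<close>.\<close>

lemma taylor_remainder_lip_on_balls:
  fixes f :: "'a::euclidean_space \<Rightarrow> real"
  assumes f: "\<And>p. (f has_derivative (\<lambda>h. g p \<bullet> h)) (at p)" and g: "lip_on_balls g"
  obtains L where "0 \<le> L"
    "\<And>p q. norm p \<le> B \<Longrightarrow> norm q \<le> B \<Longrightarrow> \<bar>f q - f p - g p \<bullet> (q - p)\<bar> \<le> L * (norm (q - p))\<^sup>2"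
proof -
  obtain L where L: "0 \<le> L" "\<And>x y. norm x \<le> B \<Longrightarrow> norm y \<le> B \<Longrightarrow> norm (g x - g y) \<le> L * norm (x - y)"
    using lip_on_ballsE[OF g, where B = B] by metis
  have "\<bar>f q - f p - g p \<bullet> (q - p)\<bar> \<le> L * (norm (q - p))\<^sup>2" if pq: "norm p \<le> B" "norm q \<le> B" for p q
  proof -
    define c where "c t = p + t *\<^sub>R (q - p)" for t :: real
    have "((\<lambda>t. f (c t)) has_real_derivative (g (c t) \<bullet> (q - p))) (at t)" for t
    proof -
      have "(c has_derivative (\<lambda>h. h *\<^sub>R (q - p))) (at t)"
        unfolding c_def by (auto intro!: derivative_eq_intros)
      then have "((f \<circ> c) has_derivative (\<lambda>h. g (c t) \<bullet> h) \<circ> (\<lambda>h. h *\<^sub>R (q - p))) (at t)"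
        by (rule diff_chain_at[OF _ f])
      then show ?thesis by (simp add: has_field_derivative_def o_def mult_commute_abs)
    qed
    then obtain t where t: "0 < t" "t < 1" "f (c 1) - f (c 0) = (1 - 0) * (g (c t) \<bullet> (q - p))"
      using MVT2[of 0 1 "\<lambda>t. f (c t)" "\<lambda>t. g (c t) \<bullet> (q - p)"] by auto
    have "c t = (1 - t) *\<^sub>R p + t *\<^sub>R q" by (simp add: c_def algebra_simps)
    then have "c t \<in> cball 0 B"
      using convexD[OF convex_cball, of p 0 B q "1 - t" t] pq t by simp
    then have "norm (g (c t) - g p) \<le> L * norm (c t - p)" using pq by (intro L) auto
    also have "\<dots> \<le> L * (1 * norm (q - p))"
      using L(1) t by (intro mult_left_mono) (auto simp: c_def intro!: mult_left_le_one_le)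
    finally have "norm (g (c t) - g p) * norm (q - p) \<le> L * norm (q - p) * norm (q - p)"
      by (intro mult_right_mono) auto
    moreover have "f q - f p - g p \<bullet> (q - p) = (g (c t) - g p) \<bullet> (q - p)"
      using t(3) by (simp add: c_def inner_diff_left)
    ultimately show ?thesis
      using Cauchy_Schwarz_ineq2[of "g (c t) - g p" "q - p"] by (simp add: power2_eq_square mult.assoc)
  qed
  then show ?thesis using that L(1) by blast
qed

text \<open>The gradient in the ambient Euclidean space. Here \<open>e\<close> is twice the residual
  at the sampled entry, and since that entry reads only row \<open>i\<close> of \<open>U\<close> and
  row \<open>j\<close> of \<open>V\<close>, all other rows of the gradient vanish.\<close>

definition g_grad ::
  "real ^ 'n ^ 'm \<Rightarrow> real \<Rightarrow> 'm \<times> 'n \<Rightarrow> ('m::finite, 'n::finite, 'k::finite) triple \<Rightarrow> ('m, 'n, 'k) triple" where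
  "g_grad A lam = (\<lambda>(i, j) (U, x, V).
     let e = 2 * ((\<Sum>l\<in>UNIV. U$i$l * x$l * V$j$l) - A$i$j)
     in (\<chi> r l. if r = i then e * (x$l * V$j$l) else 0,
         \<chi> l. e * (U$i$l * V$j$l) + 2 * lam * x$l,
         \<chi> r l. if r = j then e * (U$i$l * x$l) else 0))"

lemma p_mat_nth: "p_mat (U, x, V) $ i $ j = (\<Sum>l\<in>UNIV. U$i$l * x$l * V$j$l)"
  by (simp add: p_mat_def diag_mat_def matrix_matrix_mult_def transpose_def if_distrib[of "\<lambda>a. _ * a"] cong: if_cong)

lemma inner_single_row:
  "(\<chi> r l. if r = i then c l else 0) \<bullet> (H :: real^'k^'m) = (\<Sum>l\<in>UNIV. c l * H$i$l)"
proof -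
  have "(\<chi> r l. if r = i then c l else 0) \<bullet> H
      = (\<Sum>r\<in>UNIV. if r = i then (\<Sum>l\<in>UNIV. c l * H$r$l) else 0)"
    unfolding inner_vec_def by (intro sum.cong) auto
  then show ?thesis by simp
qed

lemma g_loss_has_derivative:
  "(g_loss A lam w has_derivative (\<lambda>h. g_grad A lam w p \<bullet> h)) (at p)"
proof -
  obtain i j where w: "w = (i, j)" by (cases w)
  obtain U x V where p: "p = (U, x, V)" by (cases p)
  have g: "g_loss A lam w = (\<lambda>p. (A$i$j - (\<Sum>l\<in>UNIV. fst p$i$l * fst (snd p)$l * snd (snd p)$j$l))\<^sup>2
      + lam * (\<Sum>l\<in>UNIV. (fst (snd p)$l)\<^sup>2))"
    unfolding g_loss_def power2_norm_eq_inner
    by (auto simp: w p_mat_nth fun_eq_iff inner_vec_def power2_eq_square)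
  have nth: "((\<lambda>p. f p $ l) has_derivative (\<lambda>h. f' h $ l)) (at p)" if "(f has_derivative f') (at p)"
    for f :: "_ \<Rightarrow> 'x::real_normed_vector^'y" and f' l
    using that by (rule bounded_linear.has_derivative[OF bounded_linear_vec_nth])
  define D where "D h = (\<Sum>l\<in>UNIV. x$l * V$j$l * fst h$i$l + U$i$l * V$j$l * fst (snd h)$l + U$i$l * x$l * snd (snd h)$j$l)" for h :: "(_, _, _) triple"
  have 1: "((\<lambda>p. \<Sum>l\<in>UNIV. fst p$i$l * fst (snd p)$l * snd (snd p)$j$l) has_derivative D) (at p)"
    unfolding D_def
    by (rule derivative_eq_intros nth refl)+ (simp add: p fun_eq_iff algebra_simps)
  have 2: "((\<lambda>p. \<Sum>l\<in>UNIV. (fst (snd p)$l)\<^sup>2) has_derivative (\<lambda>h. \<Sum>l\<in>UNIV. 2 * x$l * fst (snd h)$l)) (at p)"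
    by (rule derivative_eq_intros nth refl)+ (simp add: p fun_eq_iff algebra_simps)
  define e where "e = 2 * ((\<Sum>l\<in>UNIV. U$i$l * x$l * V$j$l) - A$i$j)"
  have "(g_loss A lam w has_derivative (\<lambda>h. e * D h + lam * (\<Sum>l\<in>UNIV. 2 * x$l * fst (snd h)$l))) (at p)"
    unfolding g by (rule derivative_eq_intros 1 2 refl)+ (simp add: p e_def fun_eq_iff algebra_simps)
  moreover have "g_grad A lam w p \<bullet> h = e * D h + lam * (\<Sum>l\<in>UNIV. 2 * x$l * fst (snd h)$l)" for h
  proof -
    obtain Y y Z where h: "h = (Y, y, Z)" by (cases h)
    have gg: "g_grad A lam w p = (\<chi> r l. if r = i then e * (x$l * V$j$l) else 0,
        \<chi> l. e * (U$i$l * V$j$l) + 2 * lam * x$l, \<chi> r l. if r = j then e * (U$i$l * x$l) else 0)"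
      by (simp only: g_grad_def w p case_prod_conv Let_def e_def)
    have "g_grad A lam w p \<bullet> h = (\<Sum>l\<in>UNIV. e * (x$l * V$j$l) * Y$i$l)
        + ((\<Sum>l\<in>UNIV. (e * (U$i$l * V$j$l) + 2 * lam * x$l) * y$l)
        + (\<Sum>l\<in>UNIV. e * (U$i$l * x$l) * Z$j$l))"
      by (simp add: gg h inner_single_row) (simp add: inner_vec_def)
    also have "\<dots> = e * D h + lam * (\<Sum>l\<in>UNIV. 2 * x$l * fst (snd h)$l)"
      unfolding D_def h by (simp add: sum_distrib_left sum.distrib[symmetric] algebra_simps)
    finally show ?thesis .
  qed
  ultimately show ?thesis by presburger
qed

lemma lip_on_balls_g_grad:
  "lip_on_balls (g_grad A lam w :: ('m::finite, 'n::finite, 'k::finite) triple \<Rightarrow> _)"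
proof -
  have if_lip: "lip_on_balls f \<Longrightarrow> lip_on_balls (\<lambda>x. if b then f x else 0)"
    for f :: "('m, 'n, 'k) triple \<Rightarrow> real" and b by (cases b) auto
  show ?thesis
    unfolding g_grad_def case_prod_beta Let_def
    by (intro lip_on_balls_Pair lip_on_balls_vec)
      (simp_all, (intro lip_on_balls_intros if_lip)+)
qed

section \<open>Series of bounded martingale differences\<close>

lemma summable_inverse_Suc_squares: "summable (\<lambda>j. 1 / (real (Suc j))\<^sup>2)"
  using inverse_power_summable[of 2, where 'a = real] summable_Suc_iff[of "\<lambda>n. inverse (real n ^ 2)"]
  by (simp add: inverse_eq_divide)

text \<open>The difference of consecutive cubes is \<open>3 * y^2 + 3 * y + 1\<close>, and each
  lower power is at most \<open>y^2\<close> for \<open>y \<ge> 1\<close>, whence 7 = 3 + 3 +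
  1.\<close>

lemma cube_block_length: "real ((Suc (Suc j))^3) - real ((Suc j)^3) \<le> 7 * (real (Suc j))\<^sup>2"
proof -
  have "(y + 1)^3 - y^3 \<le> 7 * y\<^sup>2" if "1 \<le> y" for y :: real
  proof -
    have "y * 1 \<le> y * y" "1 * 1 \<le> y * y" using that by (intro mult_mono; simp)+
    then show ?thesis by (simp add: power3_eq_cube power2_eq_square algebra_simps)
  qed
  from this[of "real (Suc j)"] show ?thesis by (simp add: algebra_simps)
qed

lemma summable_from_cube_blocks:
  fixes a :: "nat \<Rightarrow> real"
  assumes bd: "\<And>i. \<bar>a i\<bar> \<le> B / real (Suc i)"
    and sm: "summable (\<lambda>j. \<Sum>i\<in>{(Suc j)^3..<(Suc (Suc j))^3}. a i)"
  shows "summable a"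
proof -
  define N where "N j = (Suc j)^3" for j :: nat
  have N_le: "N i \<le> N j \<longleftrightarrow> i \<le> j" for i j by (simp add: N_def)
  have N_less: "N i < N j \<longleftrightarrow> i < j" for i j by (meson N_le not_le)
  have B0: "0 \<le> B" using bd[of 0] by simp
  define S where "S n = (\<Sum>i<n. a i)" for n
  have blk: "S n - S m = (\<Sum>i\<in>{m..<n}. a i)" if "m \<le> n" for m n
    using sum_diff_nat_ivl[of 0 m n a] that by (simp add: S_def atLeast0LessThan)
  have S_eq: "S (N j) = S (N 0) + (\<Sum>j'<j. \<Sum>i\<in>{N j'..<N (Suc j')}. a i)" for j
  proof (induction j)
    case (Suc j)
    then show ?case using blk[of "N j" "N (Suc j)"] N_le[of j "Suc j"] by simp
  qed simp
  obtain l where l: "(\<lambda>j. \<Sum>j'<j. \<Sum>i\<in>{N j'..<N (Suc j')}. a i) \<longlonglongrightarrow> l"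
    using sm unfolding summable_def sums_def N_def by blast
  have lim: "(\<lambda>j. S (N j)) \<longlonglongrightarrow> S (N 0) + l"
    using tendsto_add[OF tendsto_const[of "S (N 0)"] l] unfolding S_eq[symmetric] .
  \<comment> \<open>At most \<open>7 * (real (Suc j))^2\<close> terms, each bounded by B over the
    cube of \<open>Suc j\<close>.\<close>
  have within: "\<bar>S n - S (N j)\<bar> \<le> 7 * B / real (Suc j)" if "N j \<le> n" "n < N (Suc j)" for n j
  proof -
    have "\<bar>S n - S (N j)\<bar> \<le> (\<Sum>i\<in>{N j..<n}. B / real (N j))"
      unfolding blk[OF that(1)]
    proof (intro order_trans[OF sum_abs] sum_mono)
      fix i assume "i \<in> {N j..<n}"
      then have "real (N j) \<le> real (Suc i)" by (subst of_nat_le_iff) simp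
      moreover have "0 < real (N j)" by (simp add: N_def)
      ultimately have "B / real (Suc i) \<le> B / real (N j)"
        using B0 by (intro divide_left_mono) auto
      then show "\<bar>a i\<bar> \<le> B / real (N j)" using bd[of i] by linarith
    qed
    also have "\<dots> = (real n - real (N j)) * (B / real (N j))" using that by (simp add: of_nat_diff)
    also have "\<dots> \<le> (7 * (real (Suc j))\<^sup>2) * (B / real (N j))"
    proof (rule mult_right_mono)
      have "real n \<le> real (N (Suc j))" using that(2) by (subst of_nat_le_iff) simp
      then show "real n - real (N j) \<le> 7 * (real (Suc j))\<^sup>2"
        using cube_block_length[of j] unfolding N_def by linarith
    qed (use B0 in simp)
    also have "real (N j) = (real (Suc j))^3" by (simp add: N_def)
    also have "7 * (real (Suc j))\<^sup>2 * (B / (real (Suc j))^3) = 7 * B / real (Suc j)"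
      by (simp add: power2_eq_square power3_eq_cube del: of_nat_Suc)
    finally show ?thesis .
  qed
  \<comment> \<open>The blocks begin at \<open>N 0 = 1\<close>; the single term with index 0 is
    carried separately as \<open>S (N 0)\<close>.\<close>
  have cover: "\<exists>j. N j \<le> n \<and> n < N (Suc j)" if "1 \<le> n" for n
    using that
  proof (induction n rule: dec_induct)
    case base then show ?case by (intro exI[of _ 0]) (simp add: N_def eval_nat_numeral)
  next
    case (step n)
    then obtain j where j: "N j \<le> n" "n < N (Suc j)" by blast
    show ?case
    proof (cases "Suc n < N (Suc j)")
      case True then show ?thesis using j by (intro exI[of _ j]) simp
    next
      case False
      then have "Suc n = N (Suc j)" using j by simp
      then show ?thesis using N_less[of "Suc j" "Suc (Suc j)"] by (intro exI[of _ "Suc j"]) simp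
    qed
  qed
  have "S \<longlonglongrightarrow> S (N 0) + l"
  proof (rule LIMSEQ_I)
    fix e :: real assume e: "0 < e"
    have "(\<lambda>j. 7 * B / real (Suc j)) \<longlonglongrightarrow> 0"
      using LIMSEQ_Suc[OF lim_const_over_n[of "7 * B"]] by simp
    then obtain J1 where J1: "\<And>j. j \<ge> J1 \<Longrightarrow> 7 * B / real (Suc j) < e / 2"
      using LIMSEQ_D[of _ 0 "e/2"] e B0 by (metis abs_less_iff diff_zero half_gt_zero real_norm_def)
    obtain J2 where J2: "\<And>j. j \<ge> J2 \<Longrightarrow> norm (S (N j) - (S (N 0) + l)) < e / 2"
      using LIMSEQ_D[OF lim, of "e/2"] e by auto
    have "norm (S n - (S (N 0) + l)) < e" if "N (max J1 J2) \<le> n" for n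
    proof -
      have "1 \<le> N (max J1 J2)" by (simp add: N_def)
      from cover[OF order_trans[OF this that]]
      obtain j where j: "N j \<le> n" "n < N (Suc j)" by blast
      then have "max J1 J2 \<le> j" using that N_less[of "max J1 J2" "Suc j"] by linarith
      then have "\<bar>S n - S (N j)\<bar> < e / 2" "\<bar>S (N j) - (S (N 0) + l)\<bar> < e / 2"
        using order.strict_trans1[OF within[OF j] J1[of j]] J2[of j] by auto
      then show ?thesis unfolding real_norm_def by linarith
    qed
    then show "\<exists>no. \<forall>n\<ge>no. norm (S n - (S (N 0) + l)) < e" by blast
  qed
  then show ?thesis unfolding summable_def sums_def S_def by blast
qed

context prob_space
begin

text \<open>By Tonelli the series of absolute values has finite expectation, hence is finite almost
  everywhere.\<close>

lemma AE_summable_of_summable_expectation: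
  fixes f :: "nat \<Rightarrow> 'a \<Rightarrow> real"
  assumes int: "\<And>n. integrable M (f n)"
    and sm: "summable (\<lambda>n. expectation (\<lambda>z. \<bar>f n z\<bar>))"
  shows "AE z in M. summable (\<lambda>n. f n z)"
proof -
  have "(\<integral>\<^sup>+z. (\<Sum>n. ennreal \<bar>f n z\<bar>) \<partial>M) = (\<Sum>n. \<integral>\<^sup>+z. ennreal \<bar>f n z\<bar> \<partial>M)"
    using int by (intro nn_integral_suminf) simp
  also have "\<dots> = (\<Sum>n. ennreal (expectation (\<lambda>z. \<bar>f n z\<bar>)))"
    using int by (simp add: nn_integral_eq_integral)
  also have "\<dots> \<noteq> \<infinity>"
    by (subst suminf_ennreal2[OF _ sm]) auto
  finally have "(\<integral>\<^sup>+z. (\<Sum>n. ennreal \<bar>f n z\<bar>) \<partial>M) \<noteq> \<infinity>" .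
  moreover have [measurable]: "f n \<in> borel_measurable M" for n using int by simp
  have "(\<lambda>z. \<Sum>n. ennreal \<bar>f n z\<bar>) \<in> borel_measurable M"
    by measurable
  ultimately have "AE z in M. (\<Sum>n. ennreal \<bar>f n z\<bar>) \<noteq> \<infinity>"
    by (rule nn_integral_PInf_AE[rotated])
  then show ?thesis
  proof eventually_elim
    case (elim z)
    then have "summable (\<lambda>n. \<bar>f n z\<bar>)" by (intro summable_suminf_not_top) auto
    then show ?case by (rule summable_rabs_cancel)
  qed
qed

text \<open>Measurability is automatic because \<open>\<phi>\<close> factors through finitely many coordinates of a finite type.\<close>
lemma adapted_measurable:
  fixes \<omega> :: "nat \<Rightarrow> 'a \<Rightarrow> 'b::finite" and \<phi> :: "(nat \<Rightarrow> 'b) \<Rightarrow> real"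
  assumes \<omega>: "\<And>i. \<omega> i \<in> measurable M (count_space UNIV)"
    and dep: "\<And>u v. (\<And>i. i < t \<Longrightarrow> u i = v i) \<Longrightarrow> \<phi> u = \<phi> v"
  shows "(\<lambda>z. \<phi> (\<lambda>i. \<omega> i z)) \<in> borel_measurable M"
proof -
  have "(\<lambda>z. restrict (\<lambda>i. \<omega> i z) {..<t}) \<in> measurable M (PiM {..<t} (\<lambda>_. count_space UNIV))"
    using \<omega> by (intro measurable_restrict) auto
  moreover have "\<phi> \<in> borel_measurable (PiM {..<t} (\<lambda>_. count_space (UNIV :: 'b set)))"
    by (subst count_space_PiM_finite) (auto simp: countable_finite)
  ultimately have "(\<lambda>z. \<phi> (restrict (\<lambda>i. \<omega> i z) {..<t})) \<in> borel_measurable M"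
    by (rule measurable_compose)
  moreover have "\<phi> (restrict (\<lambda>i. \<omega> i z) {..<t}) = \<phi> (\<lambda>i. \<omega> i z)" for z
    by (rule dep) simp
  ultimately show ?thesis by simp
qed

text \<open>One function reads the coordinates below \<open>t\<close> and the other coordinate
  \<open>t\<close>, and disjoint blocks of an independent family are independent.\<close>

lemma adapted_indep:
  fixes \<omega> :: "nat \<Rightarrow> 'a \<Rightarrow> 'b::finite" and \<phi> :: "(nat \<Rightarrow> 'b) \<Rightarrow> real" and \<psi> :: "'b \<Rightarrow> real"
  assumes indep: "indep_vars (\<lambda>_. count_space UNIV) \<omega> UNIV"
    and dep: "\<And>u v. (\<And>i. i < t \<Longrightarrow> u i = v i) \<Longrightarrow> \<phi> u = \<phi> v"
  shows "indep_var borel (\<lambda>z. \<phi> (\<lambda>i. \<omega> i z)) borel (\<lambda>z. \<psi> (\<omega> t z))"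
proof -
  have "indep_var (PiM {..<t} (\<lambda>_. count_space UNIV)) (\<lambda>z. restrict (\<lambda>i. \<omega> i z) {..<t})
      (PiM {t} (\<lambda>_. count_space UNIV)) (\<lambda>z. restrict (\<lambda>i. \<omega> i z) {t})"
    by (rule indep_var_restrict[OF indep]) auto
  moreover have "\<phi> \<in> borel_measurable (PiM {..<t} (\<lambda>_. count_space (UNIV :: 'b set)))"
    by (subst count_space_PiM_finite) (auto simp: countable_finite)
  moreover have "(\<lambda>f. \<psi> (f t)) \<in> borel_measurable (PiM {t} (\<lambda>_. count_space (UNIV :: 'b set)))"
    by (subst count_space_PiM_finite) (auto simp: countable_finite)
  ultimately have "indep_var borel (\<phi> \<circ> (\<lambda>z. restrict (\<lambda>i. \<omega> i z) {..<t}))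
      borel ((\<lambda>f. \<psi> (f t)) \<circ> (\<lambda>z. restrict (\<lambda>i. \<omega> i z) {t}))"
    by (rule indep_var_compose)
  \<comment> \<open>\<open>restrict\<close> puts \<open>undefined\<close> at the coordinates from
    \<open>t\<close> on, which \<open>\<phi>\<close> does not read.\<close>
  moreover have "\<phi> (restrict (\<lambda>i. \<omega> i z) {..<t}) = \<phi> (\<lambda>i. \<omega> i z)" for z
    by (rule dep) simp
  ultimately show ?thesis by (simp add: o_def)
qed

text \<open>Freezing coordinate \<open>t\<close> replaces conditioning: \<open>d\<close> is split
  into the terms \<open>d (u(t := b))\<close> times the indicator that the coordinate equals
  \<open>b\<close>. Each coefficient depends only on the past, so the expectation factors and the
  indicator turns into \<open>w b\<close>; the resulting sum is zero for every fixed past. The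
  hypothesis \<open>zero\<close> is thus the vanishing conditional mean, stated pointwise in
  \<open>u\<close>.\<close>

lemma martingale_difference_orthogonal:
  fixes \<omega> :: "nat \<Rightarrow> 'a \<Rightarrow> 'b::finite" and \<phi> d :: "(nat \<Rightarrow> 'b) \<Rightarrow> real"
  assumes indep: "indep_vars (\<lambda>_. count_space UNIV) \<omega> UNIV"
    and pr: "\<And>b. prob {z \<in> space M. \<omega> t z = b} = w b"
    and \<phi>_dep: "\<And>u v. (\<And>i. i < t \<Longrightarrow> u i = v i) \<Longrightarrow> \<phi> u = \<phi> v"
    and d_dep: "\<And>u v. (\<And>i. i \<le> t \<Longrightarrow> u i = v i) \<Longrightarrow> d u = d v"
    and \<phi>_bd: "\<And>u. \<bar>\<phi> u\<bar> \<le> F" and d_bd: "\<And>u. \<bar>d u\<bar> \<le> D"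
    and zero: "\<And>u. (\<Sum>b\<in>UNIV. w b * d (u(t := b))) = 0"
  shows "expectation (\<lambda>z. \<phi> (\<lambda>i. \<omega> i z) * d (\<lambda>i. \<omega> i z)) = 0"
proof -
  have \<omega>: "\<omega> i \<in> measurable M (count_space UNIV)" for i
    using indep by (simp add: indep_vars_def)
  define Y where "Y z = (\<lambda>i. \<omega> i z)" for z
  define \<theta> where "\<theta> b u = \<phi> u * d (u(t := b))" for b u
  have \<theta>_dep: "\<theta> b u = \<theta> b v" if "\<And>i. i < t \<Longrightarrow> u i = v i" for b u v
    unfolding \<theta>_def using \<phi>_dep[of u v] d_dep[of "u(t := b)" "v(t := b)"] that by simp
  have \<theta>_bd: "\<bar>\<theta> b u\<bar> \<le> F * D" for b u
    unfolding \<theta>_def abs_mult by (intro mult_mono \<phi>_bd d_bd order_trans[OF abs_ge_zero \<phi>_bd]) simp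
  have \<theta>_int: "integrable M (\<lambda>z. \<theta> b (Y z))" for b
    using adapted_measurable[where \<phi> = "\<theta> b" and t = t, OF \<omega> \<theta>_dep] \<theta>_bd
    by (intro integrable_const_bound[where B = "F * D"]) (auto simp: Y_def)
  have ind_int: "integrable M (\<lambda>z. of_bool (\<omega> t z = b) :: real)" for b
    by (intro integrable_const_bound[where B = 1] measurable_compose[OF \<omega>[of t]]) auto
  have ind_exp: "expectation (\<lambda>z. of_bool (\<omega> t z = b)) = w b" for b
  proof -
    have "expectation (\<lambda>z. of_bool (\<omega> t z = b)) = expectation (indicator {z \<in> space M. \<omega> t z = b} :: 'a \<Rightarrow> real)"
      by (rule Bochner_Integration.integral_cong) (auto simp: indicator_def)
    moreover have "{z \<in> space M. \<omega> t z = b} \<inter> space M = {z \<in> space M. \<omega> t z = b}" by auto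
    ultimately show ?thesis using pr[of b] by simp
  qed
  have fac: "expectation (\<lambda>z. \<theta> b (Y z) * of_bool (\<omega> t z = b)) = expectation (\<lambda>z. \<theta> b (Y z)) * w b"
    and fac_int: "integrable M (\<lambda>z. \<theta> b (Y z) * of_bool (\<omega> t z = b))" for b
  proof -
    have "indep_var borel (\<lambda>z. \<theta> b (Y z)) borel (\<lambda>z. of_bool (\<omega> t z = b))"
      unfolding Y_def by (rule adapted_indep[where \<phi> = "\<theta> b", OF indep \<theta>_dep])
    from indep_var_lebesgue_integral[OF this \<theta>_int ind_int] indep_var_integrable[OF this \<theta>_int ind_int]
    show "expectation (\<lambda>z. \<theta> b (Y z) * of_bool (\<omega> t z = b)) = expectation (\<lambda>z. \<theta> b (Y z)) * w b"
      "integrable M (\<lambda>z. \<theta> b (Y z) * of_bool (\<omega> t z = b))" by (simp_all add: ind_exp)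
  qed
  have "\<phi> (Y z) * d (Y z) = (\<Sum>b\<in>UNIV. \<theta> b (Y z) * of_bool (\<omega> t z = b))" for z
  proof -
    have "(Y z)(t := \<omega> t z) = Y z" by (simp add: Y_def fun_eq_iff)
    then show ?thesis by (simp add: \<theta>_def of_bool_def if_distrib cong: if_cong)
  qed
  then have "expectation (\<lambda>z. \<phi> (Y z) * d (Y z))
      = expectation (\<lambda>z. \<Sum>b\<in>UNIV. \<theta> b (Y z) * of_bool (\<omega> t z = b))"
    by (simp only:)
  also have "\<dots> = (\<Sum>b\<in>UNIV. expectation (\<lambda>z. \<theta> b (Y z) * of_bool (\<omega> t z = b)))"
    by (rule Bochner_Integration.integral_sum) (rule fac_int)
  also have "\<dots> = (\<Sum>b\<in>UNIV. expectation (\<lambda>z. \<theta> b (Y z)) * w b)"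
    by (simp only: fac)
  also have "\<dots> = expectation (\<lambda>z. \<Sum>b\<in>UNIV. \<theta> b (Y z) * w b)"
    using \<theta>_int by (simp add: Bochner_Integration.integral_sum)
  also have "(\<lambda>z. \<Sum>b\<in>UNIV. \<theta> b (Y z) * w b) = (\<lambda>z. \<phi> (Y z) * (\<Sum>b\<in>UNIV. w b * d ((Y z)(t := b))))"
    by (simp add: \<theta>_def sum_distrib_left mult_ac)
  finally show ?thesis using zero by (simp add: Y_def)
qed

lemma AE_summable_martingale_differences:
  fixes \<omega> :: "nat \<Rightarrow> 'a \<Rightarrow> 'b::finite" and d :: "nat \<Rightarrow> (nat \<Rightarrow> 'b) \<Rightarrow> real"
  assumes indep: "indep_vars (\<lambda>_. count_space UNIV) \<omega> UNIV"
    and pr: "\<And>t b. prob {z \<in> space M. \<omega> t z = b} = w b"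
    and dep: "\<And>t u v. (\<And>i. i \<le> t \<Longrightarrow> u i = v i) \<Longrightarrow> d t u = d t v"
    and bd: "\<And>t u. \<bar>d t u\<bar> \<le> B / real (Suc t)"
    and zero: "\<And>t u. (\<Sum>b\<in>UNIV. w b * d t (u(t := b))) = 0"
  shows "AE z in M. summable (\<lambda>t. d t (\<lambda>i. \<omega> i z))"
proof -
  have \<omega>: "\<omega> i \<in> measurable M (count_space UNIV)" for i
    using indep by (simp add: indep_vars_def)
  define Y where "Y z = (\<lambda>i. \<omega> i z)" for z
  define s where "s m n u = (\<Sum>i\<in>{m..<n}. d i u)" for m n and u :: "nat \<Rightarrow> 'b"
  have B0: "0 \<le> B" using bd[of 0 undefined] by simp
  have s_dep: "s m n u = s m n v" if "\<And>i. i < n \<Longrightarrow> u i = v i" for m n u v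
    unfolding s_def using that by (intro sum.cong refl dep) auto
  have s_bd: "\<bar>s m n u\<bar> \<le> (\<Sum>i\<in>{m..<n}. B / real (Suc i))" for m n u
    unfolding s_def by (intro order_trans[OF sum_abs] sum_mono bd)
  have s_meas: "(\<lambda>z. s m n (Y z)) \<in> borel_measurable M" for m n
    unfolding Y_def by (rule adapted_measurable[where \<phi> = "s m n" and t = n, OF \<omega> s_dep])
  have s_int: "integrable M (\<lambda>z. s m n (Y z))" for m n
    by (rule integrable_const_bound[OF _ s_meas]) (use s_bd in \<open>auto intro!: AE_I2\<close>)
  have d_meas: "(\<lambda>z. d t (Y z)) \<in> borel_measurable M" for t
    using s_meas[of t "Suc t"] by (simp add: s_def)
  have prod_int: "integrable M (\<lambda>z. f z * g z)"
    if "f \<in> borel_measurable M" "g \<in> borel_measurable M" "\<And>z. \<bar>f z\<bar> \<le> F" "\<And>z. \<bar>g z\<bar> \<le> G"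
    for f g :: "'a \<Rightarrow> real" and F G
    using that by (intro integrable_const_bound[where B = "F * G"] AE_I2)
      (auto simp: abs_mult intro!: mult_mono order_trans[OF abs_ge_zero that(3)])
  \<comment> \<open>The partial sum up to \<open>n\<close> depends only on coordinates below
    \<open>n\<close>, so it is orthogonal to the next difference and second moments add up.\<close>
  have square: "expectation (\<lambda>z. (s m n (Y z))\<^sup>2) \<le> (\<Sum>i\<in>{m..<n}. (B / real (Suc i))\<^sup>2)" if "m \<le> n" for m n
    using that
  proof (induction n rule: dec_induct)
    case base then show ?case by (simp add: s_def)
  next
    case (step n)
    have int: "integrable M (\<lambda>z. s m n (Y z) * s m n (Y z))" "integrable M (\<lambda>z. s m n (Y z) * d n (Y z))"
      "integrable M (\<lambda>z. d n (Y z) * d n (Y z))"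
      using s_meas d_meas s_bd bd by (intro prod_int; blast)+
    have "s m (Suc n) u = s m n u + d n u" for u using step by (simp add: s_def)
    then have "expectation (\<lambda>z. (s m (Suc n) (Y z))\<^sup>2) = expectation (\<lambda>z. (s m n (Y z) * s m n (Y z)
        + 2 * (s m n (Y z) * d n (Y z))) + d n (Y z) * d n (Y z))"
      by (simp add: power2_eq_square algebra_simps)
    also have "\<dots> = expectation (\<lambda>z. s m n (Y z) * s m n (Y z)) + 2 * expectation (\<lambda>z. s m n (Y z) * d n (Y z))
        + expectation (\<lambda>z. d n (Y z) * d n (Y z))"
      using int by simp
    also have "expectation (\<lambda>z. s m n (Y z) * d n (Y z)) = 0"
      unfolding Y_def
      by (rule martingale_difference_orthogonal[OF indep pr s_dep dep s_bd bd zero]) auto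
    also have "expectation (\<lambda>z. d n (Y z) * d n (Y z)) \<le> expectation (\<lambda>z. (B / real (Suc n))\<^sup>2)"
    proof (rule integral_mono[OF int(3)])
      fix z
      have "\<bar>d n (Y z)\<bar>\<^sup>2 \<le> (B / real (Suc n))\<^sup>2" by (intro power_mono bd) simp
      then show "d n (Y z) * d n (Y z) \<le> (B / real (Suc n))\<^sup>2" by (simp add: power2_eq_square)
    qed simp
    finally show ?case using step by (simp add: power2_eq_square prob_space)
  qed
  define blk where "blk j z = s ((Suc j)^3) ((Suc (Suc j))^3) (Y z)" for j z
  \<comment> \<open>With \<open>y = real (Suc j)\<close>, a block has at most \<open>7 * y^2\<close>
    terms with second moments at most \<open>B^2 / y^6\<close>, so its second moment is at most
    \<open>7 * B^2 / y^4\<close>. Its first moment is then O(1 / y^2), which is summable.\<close>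
  have blk_bd: "expectation (\<lambda>z. \<bar>blk j z\<bar>) \<le> (7 * B\<^sup>2 + 1) / 2 * (1 / (real (Suc j))\<^sup>2)" for j
  proof -
    define y where "y = real (Suc j)"
    have y: "0 < y" by (simp add: y_def)
    let ?m = "(Suc j)^3" and ?n = "(Suc (Suc j))^3"
    have mn: "?m \<le> ?n" by (intro power_mono) auto
    have "expectation (\<lambda>z. (blk j z)\<^sup>2) \<le> (\<Sum>i\<in>{?m..<?n}. (B / real (Suc i))\<^sup>2)"
      unfolding blk_def by (rule square[OF mn])
    also have "\<dots> \<le> (\<Sum>i\<in>{?m..<?n}. (B / y^3)\<^sup>2)"
    proof (intro sum_mono power_mono divide_left_mono)
      fix i assume "i \<in> {?m..<?n}"
      then have "real ?m \<le> real (Suc i)" unfolding of_nat_le_iff by simp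
      then show "y^3 \<le> real (Suc i)" by (simp add: y_def)
    qed (use B0 y in auto)
    also have "\<dots> = (real ?n - real ?m) * (B / y^3)\<^sup>2" using mn by (simp add: of_nat_diff del: power_Suc)
    also have "\<dots> \<le> (7 * y\<^sup>2) * (B / y^3)\<^sup>2"
      unfolding y_def by (intro mult_right_mono cube_block_length) simp
    also have "\<dots> = 7 * B\<^sup>2 / y^4"
      using y by (simp add: power_divide field_simps flip: power_mult power_add)
    finally have sq: "expectation (\<lambda>z. (blk j z)\<^sup>2) \<le> 7 * B\<^sup>2 / y^4" .
    have blk_int: "integrable M (\<lambda>z. (blk j z)\<^sup>2)"
      unfolding power2_eq_square blk_def using s_meas s_bd by (intro prod_int; blast)
    have "expectation (\<lambda>z. \<bar>blk j z\<bar>) \<le> expectation (\<lambda>z. y\<^sup>2 / 2 * (blk j z)\<^sup>2 + 1 / (2 * y\<^sup>2))"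
    proof (rule integral_mono)
      show "integrable M (\<lambda>z. \<bar>blk j z\<bar>)" unfolding blk_def using s_int by simp
      show "integrable M (\<lambda>z. y\<^sup>2 / 2 * (blk j z)\<^sup>2 + 1 / (2 * y\<^sup>2))" using blk_int by simp
      fix z
      \<comment> \<open>Weighted AM-GM in place of Cauchy-Schwarz; the weight \<open>y\<close>
        brings both resulting terms to order \<open>1 / y^2\<close> in mean.\<close>
      have "0 \<le> (y * \<bar>blk j z\<bar> - 1 / y)\<^sup>2" by simp
      then show "\<bar>blk j z\<bar> \<le> y\<^sup>2 / 2 * (blk j z)\<^sup>2 + 1 / (2 * y\<^sup>2)"
        using y by (simp add: power2_diff power_mult_distrib field_simps power2_eq_square power4_eq_xxxx)
    qed
    also have "\<dots> = y\<^sup>2 / 2 * expectation (\<lambda>z. (blk j z)\<^sup>2) + 1 / (2 * y\<^sup>2)"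
      using blk_int by (simp add: prob_space)
    also have "\<dots> \<le> y\<^sup>2 / 2 * (7 * B\<^sup>2 / y^4) + 1 / (2 * y\<^sup>2)"
      by (intro add_right_mono mult_left_mono sq) simp
    also have "\<dots> = (7 * B\<^sup>2 + 1) / 2 * (1 / y\<^sup>2)"
      using y by (simp add: field_simps power2_eq_square power4_eq_xxxx)
    finally show ?thesis by (simp add: y_def)
  qed
  have "summable (\<lambda>j. (7 * B\<^sup>2 + 1) / 2 * (1 / (real (Suc j))\<^sup>2))"
    by (intro summable_mult summable_inverse_Suc_squares)
  then have "summable (\<lambda>j. expectation (\<lambda>z. \<bar>blk j z\<bar>))"
  proof (rule summable_comparison_test'[where N = 0])
    fix j
    have "0 \<le> expectation (\<lambda>z. \<bar>blk j z\<bar>)" by (intro Bochner_Integration.integral_nonneg) simp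
    then show "norm (expectation (\<lambda>z. \<bar>blk j z\<bar>)) \<le> (7 * B\<^sup>2 + 1) / 2 * (1 / (real (Suc j))\<^sup>2)"
      using blk_bd[of j] by (simp only: real_norm_def abs_of_nonneg)
  qed
  then have "AE z in M. summable (\<lambda>j. blk j z)"
    by (intro AE_summable_of_summable_expectation) (simp add: blk_def s_int)
  then show ?thesis
  proof eventually_elim
    case (elim z)
    then show ?case
      unfolding blk_def s_def Y_def
      by (rule summable_from_cube_blocks[where a = "\<lambda>t. d t (\<lambda>i. \<omega> i z)", OF bd])
  qed
qed

end

section \<open>Descent with summable errors\<close>

lemma convergent_of_summable_increments:
  fixes f :: "nat \<Rightarrow> real"
  assumes "summable (\<lambda>n. f (Suc n) - f n)"
  shows "convergent f"
proof -
  have "convergent (\<lambda>n. (\<Sum>i<n. f (Suc i) - f i) + f 0)"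
    using assms by (intro convergent_add convergent_const) (simp add: summable_iff_convergent)
  then show ?thesis by (simp add: sum_lessThan_telescope)
qed

text \<open>The increments of \<open>h\<^sup>2\<close> are absolutely summable, so \<open>h\<close> has a limit, and a positive limit would
  contradict the divergence of the harmonic series.\<close>
lemma tendsto_zero_of_summable_harmonic_weights:
  fixes h :: "nat \<Rightarrow> real"
  assumes nonneg: "\<And>t. 0 \<le> h t"
    and incr: "\<And>t. \<bar>h (Suc t) - h t\<bar> \<le> L / real (Suc t)"
    and sm: "summable (\<lambda>t. h t / real (Suc t))"
  shows "h \<longlonglongrightarrow> 0"
proof -
  have L0: "0 \<le> L" using incr[of 0] by simp
  \<comment> \<open>The bound \<open>L / real (Suc t)\<close> on the increments of \<open>h\<close>
    is not summable; squaring supplies the extra factor \<open>h t\<close>, for which summability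
    against the harmonic weights is known.\<close>
  have sq_incr: "\<bar>(h (Suc t))\<^sup>2 - (h t)\<^sup>2\<bar> \<le> 2 * L * (h t / real (Suc t)) + L\<^sup>2 * (1 / (real (Suc t))\<^sup>2)" for t
  proof -
    have "\<bar>(h (Suc t))\<^sup>2 - (h t)\<^sup>2\<bar> = \<bar>h (Suc t) - h t\<bar> * (h (Suc t) + h t)"
      using nonneg[of t] nonneg[of "Suc t"] by (simp add: power2_eq_square square_diff_square_factored abs_mult)
    also have "\<dots> \<le> L / real (Suc t) * (2 * h t + L / real (Suc t))"
      using incr[of t] nonneg[of t] nonneg[of "Suc t"] L0 by (intro mult_mono) auto
    also have "\<dots> = 2 * L * (h t / real (Suc t)) + L\<^sup>2 * (1 / (real (Suc t))\<^sup>2)"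
      by (simp add: power2_eq_square distrib_left del: of_nat_Suc)
    finally show ?thesis .
  qed
  have "summable (\<lambda>t. 2 * L * (h t / real (Suc t)) + L\<^sup>2 * (1 / (real (Suc t))\<^sup>2))"
    by (intro summable_add summable_mult sm summable_inverse_Suc_squares)
  then have "summable (\<lambda>t. (h (Suc t))\<^sup>2 - (h t)\<^sup>2)"
    by (rule summable_comparison_test'[where N = 0]) (simp only: real_norm_def sq_incr)
  then obtain l where "(\<lambda>t. (h t)\<^sup>2) \<longlonglongrightarrow> l"
    using convergent_of_summable_increments[of "\<lambda>t. (h t)\<^sup>2"] by (auto simp: convergent_def)
  then have "(\<lambda>t. sqrt ((h t)\<^sup>2)) \<longlonglongrightarrow> sqrt l" by (rule tendsto_real_sqrt)
  then have lim: "h \<longlonglongrightarrow> sqrt l" using nonneg by simp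
  have "sqrt l = 0"
  proof (rule ccontr)
    assume "sqrt l \<noteq> 0"
    moreover have "0 \<le> sqrt l" using lim nonneg by (intro LIMSEQ_le_const[OF lim]) auto
    ultimately have l: "0 < sqrt l / 2" "sqrt l / 2 < sqrt l" by auto
    then have "\<forall>\<^sub>F t in sequentially. sqrt l / 2 < h t" using order_tendstoD(1)[OF lim] by blast
    then obtain N where N: "\<And>t. N \<le> t \<Longrightarrow> sqrt l / 2 < h t" by (auto simp: eventually_sequentially)
    have "summable (\<lambda>t. sqrt l / 2 * (1 / real (Suc t)))"
    proof (rule summable_comparison_test'[OF sm])
      fix t assume "N \<le> t"
      then have "sqrt l / 2 / real (Suc t) \<le> h t / real (Suc t)"
        using N[of t] by (intro divide_right_mono) auto
      then show "norm (sqrt l / 2 * (1 / real (Suc t))) \<le> h t / real (Suc t)" using l by simp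
    qed
    then have "summable (\<lambda>t. 1 / real (Suc t))" using l by (subst (asm) summable_cmult_iff) auto
    then have "summable (\<lambda>t. inverse (real (Suc t)))" by (simp add: inverse_eq_divide)
    then have "summable (\<lambda>t. inverse (real t))" by (subst (asm) summable_Suc_iff)
    then show False using not_summable_harmonic[where 'a = real] by simp
  qed
  then show ?thesis using lim by simp
qed

text \<open>Telescoping expresses the partial sums of \<open>h\<close> through \<open>F\<close> and
  the errors; as \<open>F\<close> is nonnegative they are bounded, so \<open>h\<close> is summable
  and the increments of \<open>F\<close> are too.\<close>

lemma descent_with_summable_errors:
  fixes F h e :: "nat \<Rightarrow> real"
  assumes F: "\<And>t. 0 \<le> F t" and h: "\<And>t. 0 \<le> h t"
    and step: "\<And>t. F (Suc t) = F t - h t + e t" and e: "summable e"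
  shows "convergent F" "summable h"
proof -
  have eq: "(\<Sum>t<n. h t) = F 0 - F n + (\<Sum>t<n. e t)" for n
    by (induction n) (auto simp: step)
  obtain K where K: "\<And>n. norm (\<Sum>t<n. e t) \<le> K"
    using e by (metis BseqE convergent_imp_Bseq summable_iff_convergent)
  show h_sm: "summable h"
  proof (rule summableI_nonneg_bounded[OF h])
    fix n show "(\<Sum>t<n. h t) \<le> F 0 + K" using eq[of n] F[of n] K[of n] by (simp add: abs_le_iff)
  qed
  have "summable (\<lambda>t. e t - h t)" by (intro summable_diff e h_sm)
  then have "summable (\<lambda>t. F (Suc t) - F t)" by (simp add: step)
  then show "convergent F" by (rule convergent_of_summable_increments)
qed

text \<open>Comparison with the telescoping series of \<open>1 / (n * (n + 1))\<close>. The bound 2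
  is coarser than the limit pi^2 / 6, but lies below the (pi^2 + 12) / 6 occurring in Phi.\<close>

lemma sum_inverse_squares_le: "(\<Sum>i<n. 1 / (real (Suc i))\<^sup>2) \<le> 2"
proof -
  have "(\<Sum>i<Suc n. 1 / (real (Suc i))\<^sup>2) \<le> 2 - 1 / real (Suc n)" for n
  proof (induction n)
    case (Suc n)
    define y where "y = real (Suc n)"
    have y: "0 < y" by (simp add: y_def)
    have "1 / (y + 1)\<^sup>2 \<le> 1 / (y * (y + 1))"
      using y by (intro divide_left_mono) (auto simp: power2_eq_square intro!: mult_right_mono)
    also have "\<dots> = 1 / y - 1 / (y + 1)" using y by (simp add: field_simps)
    finally have "1 / (real (Suc (Suc n)))\<^sup>2 \<le> 1 / real (Suc n) - 1 / real (Suc (Suc n))"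
      by (simp add: y_def add_ac)
    then show ?case using Suc by (subst sum.lessThan_Suc) linarith
  qed simp
  moreover have "(\<Sum>i<n. 1 / (real (Suc i))\<^sup>2) \<le> (\<Sum>i<Suc n. 1 / (real (Suc i))\<^sup>2)" by simp
  moreover have "0 \<le> 1 / real (Suc n)" by simp
  ultimately show ?thesis by (meson diff_le_eq le_add_same_cancel1 order_trans)
qed

text \<open>A gradient step for \<open>(c \<bullet> x - a)^2 + lam * (norm x)^2\<close>, written
  with half the gradient, \<open>v\<close>. The first-order part of the new squared norm is a convex
  combination of the old one and \<open>\<alpha> / (4 * lam)\<close>, with weight
  \<open>4 * s * lam\<close> on the latter, so it cannot exceed the maximum; only the part of order
  \<open>s^2\<close> can increase it.\<close>

lemma ridge_step:
  fixes c x :: "'a::real_inner"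
  assumes c: "norm c \<le> 1" and a: "a\<^sup>2 \<le> \<alpha>" and lam: "0 < lam" and s: "0 \<le> s" "4 * s * lam \<le> 1"
  shows "max ((norm (x - s *\<^sub>R ((2 * (c \<bullet> x - a)) *\<^sub>R c + (2 * lam) *\<^sub>R x)))\<^sup>2) (\<alpha> / (4 * lam))
    \<le> max ((norm x)\<^sup>2) (\<alpha> / (4 * lam)) + s\<^sup>2 * (16 * \<alpha> + 8 * (2 + lam\<^sup>2) * (norm x)\<^sup>2)"
proof -
  define p where "p = c \<bullet> x"
  define v where "v = (p - a) *\<^sub>R c + lam *\<^sub>R x"
  define X where "X = (norm x)\<^sup>2"
  have X0: "0 \<le> X" by (simp add: X_def)
  have \<alpha>0: "0 \<le> \<alpha>" using a zero_le_power2[of a] by linarith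
  have "\<bar>p\<bar> \<le> 1 * norm x"
    unfolding p_def using c by (intro order_trans[OF Cauchy_Schwarz_ineq2] mult_right_mono) auto
  then have p: "p\<^sup>2 \<le> X" unfolding X_def by (simp add: abs_le_square_iff[symmetric])
  have "(norm v)\<^sup>2 \<le> (\<bar>p - a\<bar> + lam * norm x)\<^sup>2"
  proof (rule power_mono)
    have "norm v \<le> \<bar>p - a\<bar> * norm c + lam * norm x"
      unfolding v_def using norm_triangle_ineq[of "(p - a) *\<^sub>R c" "lam *\<^sub>R x"] lam by simp
    also have "\<bar>p - a\<bar> * norm c \<le> \<bar>p - a\<bar> * 1" using c by (intro mult_left_mono) auto
    finally show "norm v \<le> \<bar>p - a\<bar> + lam * norm x" by simp
  qed simp
  also have "\<dots> \<le> 2 * (p - a)\<^sup>2 + 2 * (lam\<^sup>2 * X)"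
    using sum_squares_bound[of "\<bar>p - a\<bar>" "lam * norm x"]
    by (simp add: power2_sum X_def power_mult_distrib)
  finally have "(norm v)\<^sup>2 \<le> 2 * (p - a)\<^sup>2 + 2 * (lam\<^sup>2 * X)" .
  moreover have "(p - a)\<^sup>2 \<le> 2 * p\<^sup>2 + 2 * a\<^sup>2"
    using sum_squares_bound[of p "- a"] by (simp add: power2_diff)
  ultimately have v: "(norm v)\<^sup>2 \<le> 4 * X + 4 * \<alpha> + 2 * (lam\<^sup>2 * X)" using p a by linarith
  \<comment> \<open>Completing the square in \<open>(p - a) * p\<close>: this is the origin of
    \<open>\<alpha> / 4\<close>, and hence of the threshold
    \<open>\<alpha> / (4 * lam)\<close>.\<close>
  have "0 \<le> (p - a / 2)\<^sup>2" by simp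
  then have "- (\<alpha> / 4) \<le> (p - a) * p" using a by (simp add: power2_eq_square algebra_simps)
  then have xv: "lam * X - \<alpha> / 4 \<le> x \<bullet> v"
    by (simp add: v_def inner_add_right p_def X_def power2_norm_eq_inner inner_commute)
  have eq: "x - s *\<^sub>R ((2 * (c \<bullet> x - a)) *\<^sub>R c + (2 * lam) *\<^sub>R x) = x - (2 * s) *\<^sub>R v"
    by (simp add: v_def p_def algebra_simps)
  have "(norm (x - (2 * s) *\<^sub>R v))\<^sup>2 = X - 4 * s * (x \<bullet> v) + 4 * s\<^sup>2 * (norm v)\<^sup>2"
    unfolding X_def power2_norm_eq_inner
    by (simp add: inner_diff_left inner_diff_right inner_commute power2_eq_square algebra_simps)
  also have "\<dots> \<le> X - 4 * s * (lam * X - \<alpha> / 4) + 4 * s\<^sup>2 * (4 * X + 4 * \<alpha> + 2 * (lam\<^sup>2 * X))"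
    using s by (intro add_mono diff_left_mono mult_left_mono xv v) auto
  also have "\<dots> = ((1 - 4 * s * lam) * X + (4 * s * lam) * (\<alpha> / (4 * lam)))
      + s\<^sup>2 * (16 * \<alpha> + 8 * (2 + lam\<^sup>2) * X)"
    using lam by (simp add: field_simps)
  also have "(1 - 4 * s * lam) * X + (4 * s * lam) * (\<alpha> / (4 * lam)) \<le> max X (\<alpha> / (4 * lam))"
    using s lam by (intro convex_bound_le) auto
  finally have "(norm (x - (2 * s) *\<^sub>R v))\<^sup>2 \<le> max X (\<alpha> / (4 * lam)) + s\<^sup>2 * (16 * \<alpha> + 8 * (2 + lam\<^sup>2) * X)"
    by simp
  moreover have "0 \<le> s\<^sup>2 * (16 * \<alpha> + 8 * (2 + lam\<^sup>2) * X)" using X0 \<alpha>0 by simp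
  ultimately show ?thesis unfolding eq X_def[symmetric] by (simp add: max_def)
qed

section \<open>Riemannian stochastic gradient descent\<close>

text \<open>\<open>U\<close> is an isometry that maps its own row \<open>r\<close> to a vector whose
  i-th entry is |r|^2; hence |r|^2 is at most |r|.\<close>

lemma norm_stiefel_row_le:
  assumes "(U :: real^'k^'n) \<in> stiefel"
  shows "norm (U $ i) \<le> 1"
proof -
  have "transpose U ** U = mat 1 + transpose (0 :: real^'k^'k) ** 0"
    using assms by (simp add: stiefel_def matrix_matrix_mult_def vec_eq_iff)
  from norm_mult_vec_gram[OF this, of "U $ i"] have "norm (U *v (U $ i)) = norm (U $ i)" by simp
  moreover have "\<bar>(U *v (U $ i)) $ i\<bar> \<le> norm (U *v (U $ i))" by (rule component_le_norm_cart)
  moreover have "(U *v (U $ i)) $ i = norm (U $ i) * norm (U $ i)"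
    by (simp add: matrix_vector_mul_component dot_square_norm power2_eq_square)
  ultimately have "norm (U $ i) * norm (U $ i) \<le> norm (U $ i) * 1" by simp
  then show ?thesis by (cases "U $ i = 0") (auto simp: mult_le_cancel_left)
qed

lemma norm_stiefel_le:
  assumes "(U :: real^'k^'n) \<in> stiefel"
  shows "norm U \<le> real CARD('n)"
proof -
  have "norm U \<le> (\<Sum>i\<in>UNIV. norm (U $ i))"
    unfolding norm_vec_def by (rule L2_set_le_sum) simp
  also have "\<dots> \<le> (\<Sum>i\<in>(UNIV :: 'n set). 1)" by (intro sum_mono norm_stiefel_row_le assms)
  finally show ?thesis by simp
qed

text \<open>This vector is the coefficient vector of the fitted entry (i,j) as a linear function of
  \<open>x\<close>, the role of \<open>c\<close> in \<open>ridge_step\<close>.\<close>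

lemma norm_hadamard_rows_le:
  assumes "(U :: real^'k^'m) \<in> stiefel" "(V :: real^'k^'n) \<in> stiefel"
  shows "norm (\<chi> l. U$i$l * V$j$l) \<le> 1"
proof -
  have "norm (\<chi> l. U$i$l * V$j$l) \<le> norm (U $ i)"
    unfolding norm_vec_def
  proof (rule L2_set_mono)
    fix l
    have "\<bar>V$j$l\<bar> \<le> 1" using component_le_norm_cart[of "V $ j" l] norm_stiefel_row_le[OF assms(2), of j] by linarith
    then have "\<bar>U$i$l\<bar> * \<bar>V$j$l\<bar> \<le> \<bar>U$i$l\<bar> * 1" by (intro mult_left_mono) auto
    then show "norm ((\<chi> l. U$i$l * V$j$l) $ l) \<le> norm (U$i$l)" by (simp add: abs_mult)
  qed simp
  then show ?thesis using norm_stiefel_row_le[OF assms(1), of i] by linarith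
qed

section \<open>Closedness of the manifold and compactness of its bounded parts\<close>

lemma lip_on_balls_continuous_on:
  assumes "lip_on_balls f"
  shows "continuous_on S f"
proof (rule continuous_on_subset[OF _ subset_UNIV], unfold continuous_on_iff, intro ballI allI impI)
  fix x :: 'a and e :: real assume e: "0 < e"
  obtain L where L: "0 \<le> L" "\<And>a b. norm a \<le> norm x + 1 \<Longrightarrow> norm b \<le> norm x + 1 \<Longrightarrow> norm (f a - f b) \<le> L * norm (a - b)"
    using lip_on_ballsE[OF assms, where B = "norm x + 1"] by metis
  show "\<exists>d>0. \<forall>x'\<in>UNIV. dist x' x < d \<longrightarrow> dist (f x') (f x) < e"
  proof (intro exI[of _ "min 1 (e / (L + 1))"] conjI ballI impI)
    show "0 < min 1 (e / (L + 1))" using e L(1) by simp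
    fix y assume y: "dist y x < min 1 (e / (L + 1))"
    then have "norm y \<le> norm x + 1" using norm_triangle_sub[of y x] by (simp add: dist_norm)
    then have "dist (f y) (f x) \<le> L * dist y x" unfolding dist_norm by (intro L) auto
    also have "\<dots> \<le> (L + 1) * dist y x" by (intro mult_right_mono) auto
    also have "\<dots> < (L + 1) * (e / (L + 1))" using y L(1) by (intro mult_strict_left_mono) auto
    finally show "dist (f y) (f x) < e" using L(1) by simp
  qed
qed

lemma closed_manifold_M: "closed (manifold_M :: ('m::finite, 'n::finite, 'k::finite) triple set)"
proof -
  have eq: "manifold_M = {p :: ('m, 'n, 'k) triple. transpose (fst p) ** fst p = mat 1}
      \<inter> {p. transpose (snd (snd p)) ** snd (snd p) = mat 1}"
    by (auto simp: manifold_M_def stiefel_def)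
  show ?thesis unfolding eq
    by (intro closed_Int closed_Collect_eq lip_on_balls_continuous_on lip_on_balls_matrix_mult
        lip_on_balls_transpose lip_on_balls_intros)
qed

lemma norm_triple_le: "norm (U, x, V) \<le> norm U + norm x + norm V"
  using norm_Pair_le[of U "(x, V)"] norm_Pair_le[of x V] by linarith

lemma compact_manifold_bounded:
  "compact {(U, x, V). (U, x, V) \<in> (manifold_M :: ('m::finite, 'n::finite, 'k::finite) triple set) \<and> (norm x)\<^sup>2 \<le> R}"
  (is "compact ?C")
proof (unfold compact_eq_bounded_closed, intro conjI)
  show "bounded ?C"
    unfolding bounded_iff
  proof (intro exI ballI)
    fix p assume "p \<in> ?C"
    then obtain U x V where p: "p = (U, x, V)" "(U, x, V) \<in> manifold_M" "(norm x)\<^sup>2 \<le> R" by auto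
    then show "norm p \<le> real CARD('m) + sqrt R + real CARD('n)"
      using norm_triple_le[of U x V] norm_stiefel_le[of U] norm_stiefel_le[of V] real_le_rsqrt[of "norm x" R]
      by (auto simp: manifold_M_def)
  qed
  have "?C = manifold_M \<inter> {p. (norm (fst (snd p)))\<^sup>2 \<le> R}" by auto
  also have "closed \<dots>"
    by (intro closed_Int closed_manifold_M closed_Collect_le continuous_intros)
  finally show "closed ?C" .
qed

text \<open>The recursion is driven by a fixed index sequence \<open>u\<close>, so it needs no
  probability space; the random iterates arise by substituting the sampled sequence for
  \<open>u\<close>.\<close>

primrec rsgd ::
  "real ^ 'n ^ 'm \<Rightarrow> real \<Rightarrow> real \<Rightarrow> ('m::finite, 'n::finite, 'k::{finite,linorder}) triple \<Rightarrow>
    (nat \<Rightarrow> 'm \<times> 'n) \<Rightarrow> nat \<Rightarrow> ('m, 'n, 'k) triple" where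
  "rsgd A lam \<Phi> p u 0 = p"
| "rsgd A lam \<Phi> p u (Suc t) = retraction_M (rsgd A lam \<Phi> p u t)
     (- (1 / ((real t + 1) * \<Phi>)) *\<^sub>R riem_grad (g_loss A lam (u t)) (rsgd A lam \<Phi> p u t))"

lemma rsgd_cong: "(\<And>i. i < t \<Longrightarrow> u i = v i) \<Longrightarrow> rsgd A lam \<Phi> p u t = rsgd A lam \<Phi> p v t"
  by (induction t) auto

text \<open>The conditions on \<open>\<Phi>\<close> are those consumed by the growth bound for
  \<open>x\<close>: \<open>\<Phi>_lam\<close> keeps the convex weight \<open>4 * s * lam\<close> at
  most 1, and \<open>\<Phi>_sq\<close> keeps the growth in step t below \<open>1 / (2 * lam)\<close>
  times \<open>1 / (real (Suc t))^2\<close> while the squared norm is at most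
  \<open>\<rho> + 1 / lam\<close>.\<close>

locale svd_rsgd =
  fixes A W :: "real ^ 'n ^ 'm" and lam \<Phi> \<alpha> \<rho> :: real
    and p0 :: "('m::finite, 'n::finite, 'k::{finite,linorder}) triple"
  assumes W_nonneg: "\<And>i j. 0 \<le> W $ i $ j"
    and W_sum: "(\<Sum>i\<in>UNIV. \<Sum>j\<in>UNIV. W $ i $ j) = 1"
    and lam_pos: "0 < lam"
    and init: "p0 \<in> manifold_M"
    and A_le: "\<And>i j. (A $ i $ j)\<^sup>2 \<le> \<alpha>"
    and \<rho>_x: "(norm (fst (snd p0)))\<^sup>2 \<le> \<rho>" and \<rho>_\<alpha>: "\<alpha> / (4 * lam) \<le> \<rho>"
    and \<Phi>_pos: "0 < \<Phi>" and \<Phi>_lam: "4 * lam \<le> \<Phi>"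
    and \<Phi>_sq: "2 * lam * (16 * \<alpha> + 8 * (2 + lam\<^sup>2) * (\<rho> + 1 / lam)) \<le> \<Phi>\<^sup>2"
begin

definition wt :: "'m \<times> 'n \<Rightarrow> real" where "wt w = W $ fst w $ snd w"

definition G_grad :: "('m, 'n, 'k) triple \<Rightarrow> ('m, 'n, 'k) triple" where
  "G_grad p = (\<Sum>w\<in>UNIV. wt w *\<^sub>R g_grad A lam w p)"

definition rg :: "'m \<times> 'n \<Rightarrow> ('m, 'n, 'k) triple \<Rightarrow> ('m, 'n, 'k) triple" where
  "rg w p = tangent_proj p (g_grad A lam w p)"

definition RG :: "('m, 'n, 'k) triple \<Rightarrow> ('m, 'n, 'k) triple" where
  "RG p = tangent_proj p (G_grad p)"

definition region :: "('m, 'n, 'k) triple set" where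
  "region = {p \<in> manifold_M. (norm (fst (snd p)))\<^sup>2 \<le> \<rho> + 1 / lam}"

definition radius :: real where "radius = real CARD('m) + sqrt (\<rho> + 1 / lam) + real CARD('n)"

abbreviation stepsize :: "nat \<Rightarrow> real" where "stepsize t \<equiv> 1 / ((real t + 1) * \<Phi>)"

abbreviation path :: "(nat \<Rightarrow> 'm \<times> 'n) \<Rightarrow> nat \<Rightarrow> ('m, 'n, 'k) triple" where "path \<equiv> rsgd A lam \<Phi> p0"

section \<open>The loss and its gradient as means over the sampled entry\<close>

lemma wt_sum: "(\<Sum>w\<in>UNIV. wt w) = 1"
  using W_sum unfolding wt_def sum.cartesian_product UNIV_Times_UNIV by (simp add: case_prod_beta)

lemma G_loss_eq: "G_loss A W lam p = (\<Sum>w\<in>UNIV. wt w * g_loss A lam w p)"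
proof -
  obtain U x V where p: "p = (U, x, V)" by (cases p)
  have "(\<Sum>w\<in>UNIV. wt w * g_loss A lam w p)
     = (\<Sum>w\<in>UNIV. W $ fst w $ snd w * (A $ fst w $ snd w - p_mat (U, x, V) $ fst w $ snd w)\<^sup>2)
      + (\<Sum>w\<in>UNIV. wt w) * (lam * (norm x)\<^sup>2)"
    by (simp add: p g_loss_def wt_def case_prod_beta distrib_left sum.distrib sum_distrib_right)
  then show ?thesis
    by (simp add: wt_sum G_loss_def p sum.cartesian_product case_prod_beta)
qed

lemma G_loss_nonneg: "0 \<le> G_loss A W lam p"
  unfolding G_loss_def using lam_pos by (auto intro!: add_nonneg_nonneg sum_nonneg W_nonneg mult_nonneg_nonneg split: prod.splits)

lemma G_loss_has_derivative: "(G_loss A W lam has_derivative (\<lambda>h. G_grad p \<bullet> h)) (at p)"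
proof -
  have eq: "G_loss A W lam = (\<lambda>p. \<Sum>w\<in>UNIV. wt w * g_loss A lam w p)"
    by (simp add: fun_eq_iff G_loss_eq del: split_paired_All)
  show ?thesis unfolding eq G_grad_def
    by (auto simp: inner_sum_left intro!: derivative_eq_intros g_loss_has_derivative)
qed

lemma riem_grad_g_loss: "p \<in> manifold_M \<Longrightarrow> riem_grad (g_loss A lam w) p = rg w p"
  unfolding rg_def by (rule riem_grad_eq_tangent_proj[OF _ g_loss_has_derivative])

lemma riem_grad_G_loss: "p \<in> manifold_M \<Longrightarrow> riem_grad (G_loss A W lam) p = RG p"
  unfolding RG_def by (rule riem_grad_eq_tangent_proj[OF _ G_loss_has_derivative])

text \<open>Unbiasedness of the stochastic gradient; it passes to Riemannian gradients because the
  projection at a fixed point is linear.\<close>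

lemma RG_eq: "RG p = (\<Sum>w\<in>UNIV. wt w *\<^sub>R rg w p)"
  unfolding RG_def rg_def G_grad_def
  by (simp add: linear_sum[OF linear_tangent_proj] linear_scale[OF linear_tangent_proj])

lemma lip_rg: "lip_on_balls (rg w)"
  unfolding rg_def[abs_def] by (intro lip_on_balls_tangent_proj lip_on_balls_g_grad)

lemma lip_G_grad: "lip_on_balls G_grad"
  unfolding G_grad_def[abs_def] by (intro lip_on_balls_intros lip_on_balls_g_grad)

lemma lip_RG: "lip_on_balls RG"
  unfolding RG_def[abs_def] by (intro lip_on_balls_tangent_proj lip_G_grad)

lemma region_norm_le: "p \<in> region \<Longrightarrow> norm p \<le> radius"
  using norm_triple_le[of "fst p" "fst (snd p)" "snd (snd p)"] norm_stiefel_le[of "fst p"]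
    norm_stiefel_le[of "snd (snd p)"] real_le_rsqrt[of "norm (fst (snd p))" "\<rho> + 1 / lam"]
  by (auto simp: region_def manifold_M_def radius_def)

section \<open>Confinement of the iterates to a compact region\<close>

lemma step_in_tangent: "p \<in> manifold_M \<Longrightarrow> s *\<^sub>R rg w p \<in> tangent_M p"
  unfolding rg_def by (intro subspace_scale subspace_tangent_M tangent_proj_in_tangent)

text \<open>Projection and retraction leave the x-component of the Euclidean step untouched, and for
  fixed \<open>U\<close>, \<open>V\<close> the sampled loss is a ridge regression with a single
  observation.\<close>

lemma x_step:
  assumes p: "p \<in> manifold_M" and s: "0 \<le> s" "4 * s * lam \<le> 1"
  shows "max ((norm (fst (snd (retraction_M p ((- s) *\<^sub>R rg w p)))))\<^sup>2) (\<alpha> / (4 * lam))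
    \<le> max ((norm (fst (snd p)))\<^sup>2) (\<alpha> / (4 * lam)) + s\<^sup>2 * (16 * \<alpha> + 8 * (2 + lam\<^sup>2) * (norm (fst (snd p)))\<^sup>2)"
proof -
  obtain U x V where pe: "p = (U, x, V)" by (cases p)
  obtain i j where w: "w = (i, j)" by (cases w)
  define c where "c = (\<chi> l. U$i$l * V$j$l)"
  have c: "norm c \<le> 1"
    unfolding c_def using p by (intro norm_hadamard_rows_le) (auto simp: pe manifold_M_def)
  have cx: "c \<bullet> x = (\<Sum>l\<in>UNIV. U$i$l * x$l * V$j$l)"
    by (simp add: c_def inner_vec_def mult_ac)
  have "fst (snd (rg w p)) = (2 * (c \<bullet> x - A$i$j)) *\<^sub>R c + (2 * lam) *\<^sub>R x"
    by (simp add: rg_def tangent_proj_def g_grad_def pe w Let_def cx) (simp add: vec_eq_iff c_def)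
  moreover have "fst (snd (retraction_M p ((- s) *\<^sub>R rg w p))) = x - s *\<^sub>R fst (snd (rg w p))"
    by (simp add: retraction_M_def pe case_prod_beta)
  ultimately show ?thesis
    using ridge_step[OF c A_le lam_pos s, of x i j] by (simp add: pe)
qed

lemma path_Suc: "path u t \<in> manifold_M \<Longrightarrow>
    path u (Suc t) = retraction_M (path u t) ((- stepsize t) *\<^sub>R rg (u t) (path u t))"
  by (simp add: riem_grad_g_loss)

text \<open>The two conjuncts need each other's induction: membership in the manifold identifies
  \<open>riem_grad\<close> and makes the row bounds available, while the norm bound controls the
  growth in the next step.\<close>

lemma path_invariant:
  "path u t \<in> manifold_M \<and> max ((norm (fst (snd (path u t))))\<^sup>2) (\<alpha> / (4 * lam))
      \<le> \<rho> + 1 / (2 * lam) * (\<Sum>i<t. 1 / (real (Suc i))\<^sup>2)"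
proof (induction t)
  case 0
  then show ?case using init \<rho>_x \<rho>_\<alpha> by simp
next
  case (Suc t)
  define p where "p = path u t"
  define s where "s = stepsize t"
  define X where "X = (norm (fst (snd p)))\<^sup>2"
  have p: "p \<in> manifold_M" using Suc by (simp add: p_def)
  have q: "path u (Suc t) = retraction_M p ((- s) *\<^sub>R rg (u t) p)"
    using path_Suc[of u t] p by (simp add: p_def s_def)
  have s0: "0 \<le> s" using \<Phi>_pos by (simp add: s_def)
  have "4 * lam * 1 \<le> \<Phi> * (real t + 1)" using \<Phi>_lam \<Phi>_pos lam_pos by (intro mult_mono) auto
  then have "4 * lam / (\<Phi> * (real t + 1)) \<le> 1" using \<Phi>_pos by (subst pos_divide_le_eq) auto
  then have s4: "4 * s * lam \<le> 1" by (simp add: s_def mult.commute)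
  have sum2: "1 / (2 * lam) * (\<Sum>i<t. 1 / (real (Suc i))\<^sup>2) \<le> 1 / (2 * lam) * 2"
    using lam_pos by (intro mult_left_mono sum_inverse_squares_le) auto
  \<comment> \<open>The growth accumulated so far is at most \<open>1 / lam\<close>, which is
    exactly the allowance built into \<open>\<Phi>_sq\<close>.\<close>
  have X: "X \<le> \<rho> + 1 / lam" using Suc sum2 lam_pos by (simp add: X_def p_def)
  have "2 * lam * (16 * \<alpha> + 8 * (2 + lam\<^sup>2) * X) \<le> 2 * lam * (16 * \<alpha> + 8 * (2 + lam\<^sup>2) * (\<rho> + 1 / lam))"
    using X lam_pos by (intro mult_left_mono add_left_mono) auto
  then have "2 * lam * (16 * \<alpha> + 8 * (2 + lam\<^sup>2) * X) \<le> \<Phi>\<^sup>2" using \<Phi>_sq by linarith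
  then have "16 * \<alpha> + 8 * (2 + lam\<^sup>2) * X \<le> \<Phi>\<^sup>2 / (2 * lam)"
    using lam_pos by (simp add: pos_le_divide_eq mult.commute)
  then have "s\<^sup>2 * (16 * \<alpha> + 8 * (2 + lam\<^sup>2) * X) \<le> s\<^sup>2 * (\<Phi>\<^sup>2 / (2 * lam))"
    by (intro mult_left_mono) auto
  also have "\<dots> = 1 / (2 * lam) * (1 / (real (Suc t))\<^sup>2)"
    using \<Phi>_pos by (simp add: s_def power_mult_distrib power_divide add.commute)
  finally have "max ((norm (fst (snd (path u (Suc t)))))\<^sup>2) (\<alpha> / (4 * lam))
      \<le> max X (\<alpha> / (4 * lam)) + 1 / (2 * lam) * (1 / (real (Suc t))\<^sup>2)"
    unfolding q X_def using x_step[OF p s0 s4, of "u t"] by linarith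
  moreover have "max X (\<alpha> / (4 * lam)) \<le> \<rho> + 1 / (2 * lam) * (\<Sum>i<t. 1 / (real (Suc i))\<^sup>2)"
    using Suc by (simp only: X_def p_def)
  moreover have "path u (Suc t) \<in> manifold_M"
    unfolding q by (intro retraction_in_manifold p step_in_tangent)
  ultimately show ?case
    unfolding sum.lessThan_Suc distrib_left by linarith
qed

lemma path_in_region: "path u t \<in> region"
proof -
  have "1 / (2 * lam) * (\<Sum>i<t. 1 / (real (Suc i))\<^sup>2) \<le> 1 / (2 * lam) * 2"
    using lam_pos by (intro mult_left_mono sum_inverse_squares_le) auto
  then show ?thesis using path_invariant[of u t] lam_pos by (simp add: region_def)
qed

text \<open>The martingale difference D_t: to first order G changes by \<open>- stepsize t\<close>
  times the inner product of \<open>RG\<close> with the sampled gradient, and this is its deviation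
  from the mean \<open>- stepsize t\<close> times the squared norm of \<open>RG\<close>.\<close>

definition noise :: "nat \<Rightarrow> (nat \<Rightarrow> 'm \<times> 'n) \<Rightarrow> real" where
  "noise t u = stepsize t * (RG (path u t) \<bullet> RG (path u t) - RG (path u t) \<bullet> rg (u t) (path u t))"

lemma noise_cong:
  assumes "\<And>i. i \<le> t \<Longrightarrow> u i = v i"
  shows "noise t u = noise t v"
proof -
  have "path u t = path v t" by (rule rsgd_cong) (simp add: assms)
  moreover have "u t = v t" by (simp add: assms)
  ultimately show ?thesis by (simp only: noise_def)
qed

lemma rg_bounded:
  obtains B where "0 \<le> B" "\<And>w p. p \<in> region \<Longrightarrow> norm (rg w p) \<le> B"
proof -
  \<comment> \<open>Packing all samples into one vector-valued map yields a bound uniform in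
    \<open>w\<close>.\<close>
  have "lip_on_balls (\<lambda>p. \<chi> w. rg w p)" by (intro lip_on_balls_vec) (simp add: lip_rg)
  then obtain B where B: "0 \<le> B" "\<And>p. norm p \<le> radius \<Longrightarrow> norm (\<chi> w. rg w p) \<le> B"
    by (metis lip_on_balls_bounded)
  have "norm (rg w p) \<le> B" if "p \<in> region" for w p
    using B(2)[OF region_norm_le[OF that]] Finite_Cartesian_Product.norm_nth_le[of "\<chi> w. rg w p" w] by simp
  then show ?thesis using that B(1) by blast
qed

lemma RG_bounded:
  obtains B where "0 \<le> B" "\<And>p. p \<in> region \<Longrightarrow> norm (RG p) \<le> B"
  using lip_on_balls_bounded[OF lip_RG, where B = radius] region_norm_le by metis

lemma noise_bounded:
  obtains B where "\<And>t u. \<bar>noise t u\<bar> \<le> B / real (Suc t)"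
proof -
  obtain M where M: "0 \<le> M" "\<And>w p. p \<in> region \<Longrightarrow> norm (rg w p) \<le> M" using rg_bounded by metis
  obtain N where N: "0 \<le> N" "\<And>p. p \<in> region \<Longrightarrow> norm (RG p) \<le> N" using RG_bounded by metis
  have "\<bar>noise t u\<bar> \<le> (N * N + N * M) / \<Phi> / real (Suc t)" for t u
  proof -
    let ?p = "path u t"
    have "\<bar>RG ?p \<bullet> RG ?p - RG ?p \<bullet> rg (u t) ?p\<bar> \<le> norm (RG ?p) * norm (RG ?p) + norm (RG ?p) * norm (rg (u t) ?p)"
      using Cauchy_Schwarz_ineq2[of "RG ?p" "RG ?p"] Cauchy_Schwarz_ineq2[of "RG ?p" "rg (u t) ?p"] by linarith
    also have "\<dots> \<le> N * N + N * M"
      using N M path_in_region[of u t] by (intro add_mono mult_mono) auto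
    finally have "stepsize t * \<bar>RG ?p \<bullet> RG ?p - RG ?p \<bullet> rg (u t) ?p\<bar> \<le> stepsize t * (N * N + N * M)"
      using \<Phi>_pos by (intro mult_left_mono) auto
    then show ?thesis using \<Phi>_pos by (simp add: noise_def abs_mult field_simps)
  qed
  then show ?thesis using that by blast
qed

text \<open>Resampling coordinate \<open>t\<close> leaves the iterate at time \<open>t\<close>
  unchanged, so the weighted sum only averages the sampled gradients.\<close>

lemma noise_mean_zero: "(\<Sum>b\<in>UNIV. wt b * noise t (u(t := b))) = 0"
proof -
  have p: "path (u(t := b)) t = path u t" for b by (rule rsgd_cong) simp
  define p where "p = path u t"
  have "(\<Sum>b\<in>UNIV. wt b * noise t (u(t := b)))
      = (\<Sum>b\<in>UNIV. stepsize t * (wt b * (RG p \<bullet> RG p)) - stepsize t * (RG p \<bullet> (wt b *\<^sub>R rg b p)))"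
    by (intro sum.cong refl) (simp add: noise_def p p_def[symmetric] algebra_simps)
  also have "\<dots> = stepsize t * ((\<Sum>b\<in>UNIV. wt b) * (RG p \<bullet> RG p)) - stepsize t * (RG p \<bullet> (\<Sum>b\<in>UNIV. wt b *\<^sub>R rg b p))"
    by (simp only: sum_subtractf sum_distrib_left sum_distrib_right inner_sum_right)
  also have "\<dots> = 0" by (simp add: wt_sum flip: RG_eq)
  finally show ?thesis .
qed

text \<open>G is smooth on the ambient space, so its Taylor expansion is taken along the straight
  segment between two iterates. The segment may leave the manifold, but it stays in a ball around
  0.\<close>

lemma step_expansion:
  obtains K where "\<And>p w s. p \<in> region \<Longrightarrow> 0 \<le> s \<Longrightarrow> s \<le> 1 / \<Phi> \<Longrightarrow>
      retraction_M p ((- s) *\<^sub>R rg w p) \<in> region \<Longrightarrow>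
      norm (retraction_M p ((- s) *\<^sub>R rg w p) - p) \<le> K * s \<and>
      \<bar>G_loss A W lam (retraction_M p ((- s) *\<^sub>R rg w p)) - G_loss A W lam p + s * (RG p \<bullet> rg w p)\<bar> \<le> K * s\<^sup>2"
proof -
  obtain M where M: "0 \<le> M" "\<And>w p. p \<in> region \<Longrightarrow> norm (rg w p) \<le> M" using rg_bounded by metis
  obtain N where N: "0 \<le> N" "\<And>p. norm p \<le> radius \<Longrightarrow> norm (G_grad p) \<le> N"
    using lip_on_balls_bounded[OF lip_G_grad, where B = radius] by metis
  obtain L where L: "0 \<le> L" "\<And>p q. norm p \<le> radius \<Longrightarrow> norm q \<le> radius \<Longrightarrow>
      \<bar>G_loss A W lam q - G_loss A W lam p - G_grad p \<bullet> (q - p)\<bar> \<le> L * (norm (q - p))\<^sup>2"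
    using taylor_remainder_lip_on_balls[OF G_loss_has_derivative lip_G_grad, where B = radius] by metis
  define c where "c = 2 * (real CARD('k) * (real CARD('k) * (real CARD('k) + 1)))"
  have c0: "0 \<le> c" by (simp add: c_def)
  define D where "D = M + c * M\<^sup>2 / \<Phi>"
  have D0: "0 \<le> D" using M(1) c0 \<Phi>_pos by (simp add: D_def)
  define K where "K = D + (L * D\<^sup>2 + N * (c * M\<^sup>2))"
  show ?thesis
  proof (rule that[of K])
    fix p w s
    assume p: "p \<in> region" and s: "0 \<le> s" "s \<le> 1 / \<Phi>"
      and qr: "retraction_M p ((- s) *\<^sub>R rg w p) \<in> region"
    define \<xi> where "\<xi> = (- s) *\<^sub>R rg w p"
    define q where "q = retraction_M p \<xi>"
    have pM: "p \<in> manifold_M" using p by (simp add: region_def)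
    have \<xi>: "\<xi> \<in> tangent_M p" unfolding \<xi>_def by (rule step_in_tangent[OF pM])
    have n\<xi>: "norm \<xi> \<le> s * M" using s M(2)[OF p, of w] by (simp add: \<xi>_def mult_left_mono)
    then have "(norm \<xi>)\<^sup>2 \<le> (s * M)\<^sup>2" by (intro power_mono) auto
    then have "c * (norm \<xi>)\<^sup>2 \<le> c * (s * M)\<^sup>2" using c0 by (intro mult_left_mono)
    moreover have "norm (q - (p + \<xi>)) \<le> c * (norm \<xi>)\<^sup>2"
      unfolding q_def c_def by (rule retraction_second_order[OF pM \<xi>])
    ultimately have err: "norm (q - (p + \<xi>)) \<le> c * M\<^sup>2 * s\<^sup>2" by (simp add: power_mult_distrib mult_ac)
    \<comment> \<open>The bound \<open>s \<le> 1 / \<Phi>\<close> turns the quadratic retraction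
      error into a linear one, which explains the second summand of \<open>D\<close>.\<close>
    have "c * M\<^sup>2 * s\<^sup>2 \<le> c * M\<^sup>2 * (s * (1 / \<Phi>))"
      unfolding power2_eq_square[of s] using s c0 by (intro mult_left_mono) auto
    then have disp: "norm (q - p) \<le> D * s"
      using norm_triangle_ineq[of "q - (p + \<xi>)" \<xi>] n\<xi> err by (simp add: D_def algebra_simps)
    have np: "norm p \<le> radius" and nq: "norm q \<le> radius"
      using region_norm_le p qr by (auto simp: q_def \<xi>_def)
    have "\<bar>G_loss A W lam q - G_loss A W lam p - G_grad p \<bullet> (q - p)\<bar> \<le> L * (D * s)\<^sup>2"
      by (intro order_trans[OF L(2)[OF np nq]] mult_left_mono power_mono disp L(1)) simp
    moreover have "\<bar>G_grad p \<bullet> (q - (p + \<xi>))\<bar> \<le> N * (c * M\<^sup>2 * s\<^sup>2)"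
      using N np by (intro order_trans[OF Cauchy_Schwarz_ineq2] mult_mono err) auto
    \<comment> \<open>Since the step is tangent, the Euclidean gradient may be replaced by its
      projection; this is where the Riemannian gradient of G appears.\<close>
    moreover have "G_grad p \<bullet> \<xi> = - s * (RG p \<bullet> rg w p)"
      using inner_tangent_proj[OF \<xi>, of "G_grad p"] by (auto simp: RG_def \<xi>_def)
    ultimately have "\<bar>G_loss A W lam q - G_loss A W lam p + s * (RG p \<bullet> rg w p)\<bar>
        \<le> L * (D * s)\<^sup>2 + N * (c * M\<^sup>2 * s\<^sup>2)"
      unfolding inner_diff_right inner_add_right by linarith
    also have "\<dots> = (L * D\<^sup>2 + N * (c * M\<^sup>2)) * s\<^sup>2" by (simp add: power_mult_distrib algebra_simps)
    also have "\<dots> \<le> K * s\<^sup>2" using D0 by (intro mult_right_mono) (auto simp: K_def)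
    finally have "\<bar>G_loss A W lam q - G_loss A W lam p + s * (RG p \<bullet> rg w p)\<bar> \<le> K * s\<^sup>2" .
    moreover have "D * s \<le> K * s"
      using s L(1) N(1) c0 by (intro mult_right_mono) (auto simp: K_def)
    ultimately show "norm (retraction_M p ((- s) *\<^sub>R rg w p) - p) \<le> K * s \<and>
      \<bar>G_loss A W lam (retraction_M p ((- s) *\<^sub>R rg w p)) - G_loss A W lam p + s * (RG p \<bullet> rg w p)\<bar> \<le> K * s\<^sup>2"
      using disp by (simp add: q_def \<xi>_def)
  qed
qed

lemma path_asymptotics:
  assumes noise: "summable (\<lambda>t. noise t u)"
  shows "convergent (\<lambda>t. G_loss A W lam (path u t))" "(\<lambda>t. norm (RG (path u t))) \<longlonglongrightarrow> 0"
proof -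
  define p where "p t = path u t" for t
  define F where "F t = G_loss A W lam (p t)" for t
  define H where "H t = (norm (RG (p t)))\<^sup>2" for t
  obtain K where K: "\<And>p w s. p \<in> region \<Longrightarrow> 0 \<le> s \<Longrightarrow> s \<le> 1 / \<Phi> \<Longrightarrow>
      retraction_M p ((- s) *\<^sub>R rg w p) \<in> region \<Longrightarrow>
      norm (retraction_M p ((- s) *\<^sub>R rg w p) - p) \<le> K * s \<and>
      \<bar>G_loss A W lam (retraction_M p ((- s) *\<^sub>R rg w p)) - G_loss A W lam p + s * (RG p \<bullet> rg w p)\<bar> \<le> K * s\<^sup>2"
    using step_expansion by blast
  have reg: "p t \<in> region" for t by (simp add: p_def path_in_region)
  have s0: "0 < stepsize t" for t using \<Phi>_pos by simp
  have s1: "stepsize t \<le> 1 / \<Phi>" for t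
  proof -
    have "1 * \<Phi> \<le> (real t + 1) * \<Phi>" using \<Phi>_pos by (intro mult_right_mono) auto
    then show ?thesis using \<Phi>_pos by (intro divide_left_mono) auto
  qed
  have q: "p (Suc t) = retraction_M (p t) ((- stepsize t) *\<^sub>R rg (u t) (p t))" for t
    using path_Suc[of u t] reg[of t] by (simp add: p_def region_def)
  have step: "norm (p (Suc t) - p t) \<le> K * stepsize t"
    "\<bar>F (Suc t) - F t + stepsize t * (RG (p t) \<bullet> rg (u t) (p t))\<bar> \<le> K * (stepsize t)\<^sup>2" for t
    using K[where p = "p t" and s = "stepsize t" and w = "u t", OF reg less_imp_le[OF s0] s1] reg[of "Suc t"] unfolding q F_def by auto
  define r where "r t = F (Suc t) - F t + stepsize t * (RG (p t) \<bullet> rg (u t) (p t))" for t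
  have "summable r"
  proof (rule summable_comparison_test'[where N = 0])
    show "summable (\<lambda>t. K / \<Phi>\<^sup>2 * (1 / (real (Suc t))\<^sup>2))" by (intro summable_mult summable_inverse_Suc_squares)
    fix t
    show "norm (r t) \<le> K / \<Phi>\<^sup>2 * (1 / (real (Suc t))\<^sup>2)"
      using step(2)[of t] by (simp add: r_def power_mult_distrib power_divide add.commute mult.commute)
  qed
  then have e: "summable (\<lambda>t. noise t u + r t)" by (intro summable_add noise)
  have descent: "F (Suc t) = F t - stepsize t * H t + (noise t u + r t)" for t
    by (simp add: r_def noise_def H_def p_def[symmetric] power2_norm_eq_inner algebra_simps)
  have "0 \<le> F t" for t by (simp add: F_def G_loss_nonneg)
  moreover have "0 \<le> stepsize t * H t" for t using s0[of t] by (simp add: H_def)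
  ultimately have conv: "convergent F" and sm: "summable (\<lambda>t. stepsize t * H t)"
    using descent_with_summable_errors[of F "\<lambda>t. stepsize t * H t", OF _ _ descent e] by auto
  show "convergent (\<lambda>t. G_loss A W lam (path u t))" using conv by (simp add: F_def[abs_def] p_def)
  obtain N where N: "0 \<le> N" "\<And>p. p \<in> region \<Longrightarrow> norm (RG p) \<le> N" using RG_bounded by metis
  obtain L where L: "0 \<le> L" "\<And>x y. norm x \<le> radius \<Longrightarrow> norm y \<le> radius \<Longrightarrow> norm (RG x - RG y) \<le> L * norm (x - y)"
    using lip_on_ballsE[OF lip_RG, where B = radius] by metis
  have "H \<longlonglongrightarrow> 0"
  proof (rule tendsto_zero_of_summable_harmonic_weights)
    show "0 \<le> H t" for t by (simp add: H_def)
    have "summable (\<lambda>t. \<Phi> * (stepsize t * H t))" by (intro summable_mult sm)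
    then show "summable (\<lambda>t. H t / real (Suc t))" using \<Phi>_pos by (simp add: add.commute)
    fix t
    let ?a = "norm (RG (p (Suc t)))" and ?b = "norm (RG (p t))"
    have "\<bar>H (Suc t) - H t\<bar> = \<bar>?a - ?b\<bar> * (?a + ?b)"
      by (simp add: H_def power2_eq_square square_diff_square_factored abs_mult)
    also have "\<dots> \<le> (L * (K * stepsize t)) * (N + N)"
    proof (rule mult_mono)
      have "\<bar>?a - ?b\<bar> \<le> norm (RG (p (Suc t)) - RG (p t))" by (rule norm_triangle_ineq3)
      also have "\<dots> \<le> L * norm (p (Suc t) - p t)" by (intro L region_norm_le reg)
      also have "\<dots> \<le> L * (K * stepsize t)" by (intro mult_left_mono step L)
      finally show le: "\<bar>?a - ?b\<bar> \<le> L * (K * stepsize t)" .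
      then show "0 \<le> L * (K * stepsize t)" by linarith
      show "?a + ?b \<le> N + N" using N(2)[OF reg, of "Suc t"] N(2)[OF reg, of t] by linarith
    qed simp
    also have "\<dots> = (L * K * (2 * N) / \<Phi>) / real (Suc t)"
      using \<Phi>_pos by (simp add: field_simps)
    finally show "\<bar>H (Suc t) - H t\<bar> \<le> (L * K * (2 * N) / \<Phi>) / real (Suc t)" .
  qed
  then have "(\<lambda>t. sqrt (H t)) \<longlonglongrightarrow> sqrt 0" by (rule tendsto_real_sqrt)
  then show "(\<lambda>t. norm (RG (path u t))) \<longlonglongrightarrow> 0" by (simp add: H_def p_def)
qed

text \<open>\<open>RG\<close> is defined and continuous on the whole ambient space, so it passes to
  the limit; closedness of the manifold then identifies its value with the Riemannian
  gradient.\<close>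

lemma limit_point_stationary:
  assumes "(\<lambda>t. norm (RG (path u t))) \<longlonglongrightarrow> 0" "strict_mono r" "(\<lambda>i. path u (r i)) \<longlonglongrightarrow> l"
  shows "stationary_point (G_loss A W lam) l"
proof -
  have l: "l \<in> manifold_M"
    using path_in_region[of u]
    by (intro closed_sequentially[OF closed_manifold_M _ assms(3)]) (auto simp: region_def)
  have "(\<lambda>i. RG (path u (r i))) \<longlonglongrightarrow> RG l"
    using continuous_on_tendsto_compose[OF lip_on_balls_continuous_on[OF lip_RG, of UNIV] assms(3)] by simp
  then have "(\<lambda>i. norm (RG (path u (r i)))) \<longlonglongrightarrow> norm (RG l)" by (rule tendsto_norm)
  moreover have "(\<lambda>i. norm (RG (path u (r i)))) \<longlonglongrightarrow> 0"
    using LIMSEQ_subseq_LIMSEQ[OF assms(1,2)] by (simp add: o_def)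
  ultimately have "RG l = 0" using LIMSEQ_unique by fastforce
  then show ?thesis using l by (simp add: stationary_point_def riem_grad_G_loss)
qed

end

theorem proposition3p14:
  fixes A W :: "real ^ 'n ^ 'm"
    and lam K \<alpha> \<rho>\<^sub>0 \<Phi> :: real
    and U\<^sub>0 :: "real ^ 'k::{finite,linorder} ^ 'm"
    and x\<^sub>0 :: "real ^ 'k::{finite,linorder}"
    and V\<^sub>0 :: "real ^ 'k::{finite,linorder} ^ 'n"
    and P :: "'a measure"
    and \<omega> :: "nat \<Rightarrow> 'a \<Rightarrow> 'm \<times> 'n"
    and S :: "nat \<Rightarrow> 'a \<Rightarrow> ('m, 'n, 'k) triple"
  assumes k_le: "CARD('k) \<le> min CARD('m) CARD('n)"
    and W_nonneg: "\<And>i j. 0 \<le> W $ i $ j"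
    and W_sum: "(\<Sum>i\<in>UNIV. \<Sum>j\<in>UNIV. W $ i $ j) = 1"
    and lam_pos: "0 < lam"
    and init: "(U\<^sub>0, x\<^sub>0, V\<^sub>0) \<in> manifold_M"
    and K_ge: "1 \<le> K"
    and alpha: "\<alpha> = Max (range (\<lambda>(i, j). (A $ i $ j)\<^sup>2))"
    and rho0: "\<rho>\<^sub>0 = max ((norm x\<^sub>0)\<^sup>2) (\<alpha> / (4 * lam))"
    and Phi: "\<Phi> = K * max ((lam + 2 * sqrt lam + 1) * \<alpha>)
      (sqrt (32 * real CARD('k) * \<alpha> * lam
        + 8 * real CARD('k) * (2 + lam\<^sup>2) * (2 * lam * \<rho>\<^sub>0 + (pi\<^sup>2 + 12) / 6)))"
    and prob: "prob_space P"
    and indep: "prob_space.indep_vars P (\<lambda>_. count_space UNIV) \<omega> UNIV"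
    and distr: "\<And>t i j. measure (distr P (count_space UNIV) (\<omega> t)) {(i, j)} = W $ i $ j"
    and S_0: "\<And>z. z \<in> space P \<Longrightarrow> S 0 z = (U\<^sub>0, x\<^sub>0, V\<^sub>0)"
    and S_Suc: "\<And>t z. z \<in> space P \<Longrightarrow> S (Suc t) z = retraction_M (S t z)
      (- (1 / ((real t + 1) * \<Phi>)) *\<^sub>R riem_grad (g_loss A lam (\<omega> t z)) (S t z))"
  defines "C \<equiv> {(U, x, V). (U, x, V) \<in> (manifold_M :: ('m, 'n, 'k) triple set)
      \<and> (norm x)\<^sup>2 \<le> \<rho>\<^sub>0 + (pi\<^sup>2 + 12) / (12 * lam)}"
  shows "(compact C \<and> (\<forall>z\<in>space P. (\<forall>t. S t z \<in> C) \<and>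
           (\<exists>r l. strict_mono r \<and> l \<in> manifold_M \<and> (\<lambda>i. S (r i) z) \<longlonglongrightarrow> l)))
    \<and> (AE z in P. convergent (\<lambda>t. G_loss A W lam (S t z)))
    \<and> (AE z in P. (\<lambda>t. norm (riem_grad (G_loss A W lam) (S t z))) \<longlonglongrightarrow> 0)
    \<and> (AE z in P. \<forall>l. (\<exists>r. strict_mono r \<and> (\<lambda>i. S (r i) z) \<longlonglongrightarrow> l) \<longrightarrow>
           stationary_point (G_loss A W lam) l)"
proof -
  interpret prob_space P by (rule prob)
  have A_le: "(A $ i $ j)\<^sup>2 \<le> \<alpha>" for i j
    unfolding alpha by (rule Max_ge) (auto intro!: image_eqI[of _ _ "(i, j)"])
  have \<alpha>0: "0 \<le> \<alpha>" using A_le[of undefined undefined] zero_le_power2 order_trans by blast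
  have \<rho>0: "0 \<le> \<rho>\<^sub>0" unfolding rho0 by (simp add: max.coboundedI1)
  define Q where "Q = 32 * real CARD('k) * \<alpha> * lam
        + 8 * real CARD('k) * (2 + lam\<^sup>2) * (2 * lam * \<rho>\<^sub>0 + (pi\<^sup>2 + 12) / 6)"
  \<comment> \<open>\<open>Q\<close> with k replaced by 1 and (pi^2 + 12) / 6 by the bound 2 on the
    sum of inverse squares; it equals the left-hand side of \<open>\<Phi>_sq\<close>.\<close>
  define q where "q = 32 * \<alpha> * lam + 8 * (2 + lam\<^sup>2) * (2 * lam * \<rho>\<^sub>0 + 2)"
  have two: "2 \<le> (pi\<^sup>2 + 12) / 6" by simp
  have "1 * q \<le> real CARD('k) * q"
    using \<alpha>0 \<rho>0 lam_pos by (intro mult_right_mono) (auto simp: q_def Suc_le_eq)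
  also have "\<dots> = 32 * real CARD('k) * \<alpha> * lam + 8 * real CARD('k) * (2 + lam\<^sup>2) * (2 * lam * \<rho>\<^sub>0 + 2)"
    by (simp add: q_def algebra_simps)
  also have "\<dots> \<le> Q" unfolding Q_def using two by (intro add_left_mono mult_left_mono) auto
  finally have qQ: "q \<le> Q" by simp
  have "8 * (2 + lam\<^sup>2) * 2 \<le> 8 * (2 + lam\<^sup>2) * (2 * lam * \<rho>\<^sub>0 + 2)"
    using lam_pos \<rho>0 by (intro mult_left_mono) auto
  then have "8 * (2 + lam\<^sup>2) * 2 \<le> q"
    using \<alpha>0 lam_pos mult_nonneg_nonneg[of \<alpha> lam] unfolding q_def by linarith
  \<comment> \<open>The summand \<open>8 * (2 + lam^2) * 2\<close> is
    \<open>32 + 16 * lam^2\<close>, so the square root in Phi already forces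
    \<open>4 * lam \<le> \<Phi>\<close>.\<close>
  then have q4: "(4 * lam)\<^sup>2 < q" by (simp add: power_mult_distrib)
  then have q0: "0 < q" by (meson le_less_trans zero_le_power2)
  have "sqrt Q \<le> 1 * max ((lam + 2 * sqrt lam + 1) * \<alpha>) (sqrt Q)" by simp
  also have "\<dots> \<le> \<Phi>"
    unfolding Phi Q_def[symmetric] using K_ge q0 qQ
    by (intro mult_right_mono) (auto simp: le_max_iff_disj)
  finally have sqrtQ: "sqrt q \<le> \<Phi>" using qQ real_sqrt_le_mono order_trans by blast
  have \<Phi>_pos: "0 < \<Phi>" using sqrtQ q0 by (meson less_le_trans real_sqrt_gt_zero)
  have \<Phi>_sq: "q \<le> \<Phi>\<^sup>2"
    using power_mono[OF sqrtQ, of 2] q0 by simp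
  have \<Phi>_lam: "4 * lam \<le> \<Phi>"
    using q4 \<Phi>_sq \<Phi>_pos by (intro power2_le_imp_le[of "4 * lam" \<Phi>]) auto
  have q_eq: "2 * lam * (16 * \<alpha> + 8 * (2 + lam\<^sup>2) * (\<rho>\<^sub>0 + 1 / lam)) = q"
    using lam_pos by (simp add: q_def field_simps)
  interpret svd_rsgd A W lam \<Phi> \<alpha> \<rho>\<^sub>0 "(U\<^sub>0, x\<^sub>0, V\<^sub>0)"
    by unfold_locales
      (use W_nonneg W_sum lam_pos init A_le \<Phi>_pos \<Phi>_lam \<Phi>_sq q_eq in \<open>auto simp: rho0\<close>)
  have S_path: "S t z = path (\<lambda>i. \<omega> i z) t" if "z \<in> space P" for t z
    by (induction t) (simp_all add: S_0 S_Suc that)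
  have "1 / lam \<le> (pi\<^sup>2 + 12) / (12 * lam)" using lam_pos by (simp add: field_simps)
  then have region_C: "region \<subseteq> C"
    unfolding region_def C_def by (auto intro: order_trans)
  have compact: "compact C" unfolding C_def by (rule compact_manifold_bounded)
  have S_C: "S t z \<in> C" if "z \<in> space P" for t z
    using path_in_region region_C S_path[OF that] by auto
  have subseq: "\<exists>r l. strict_mono r \<and> l \<in> manifold_M \<and> (\<lambda>i. S (r i) z) \<longlonglongrightarrow> l" if z: "z \<in> space P" for z
  proof -
    obtain l r where "l \<in> C" "strict_mono r" "((\<lambda>t. S t z) \<circ> r) \<longlonglongrightarrow> l"
      using compact[unfolded compact_def] S_C[OF z] by meson
    then show ?thesis by (auto simp: C_def o_def)
  qed
  have meas: "\<omega> t \<in> measurable P (count_space UNIV)" for t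
    using indep by (simp add: indep_vars_def)
  have pr: "prob {z \<in> space P. \<omega> t z = b} = wt b" for t b
  proof -
    have "{z \<in> space P. \<omega> t z = b} = \<omega> t -` {b} \<inter> space P" by auto
    then show ?thesis
      using distr[of t "fst b" "snd b"] measure_distr[OF meas[of t], of "{b}"] by (simp add: wt_def)
  qed
  obtain B where B: "\<And>t u. \<bar>noise t u\<bar> \<le> B / real (Suc t)" using noise_bounded by blast
  have "AE z in P. summable (\<lambda>t. noise t (\<lambda>i. \<omega> i z))"
    by (rule AE_summable_martingale_differences[where d = noise, OF indep pr _ B noise_mean_zero])
      (rule noise_cong)
  \<comment> \<open>The random iterates agree with \<open>path\<close> only on
    \<open>space P\<close>, so membership is carried along with the almost sure event.\<close>
  with AE_space have noise: "AE z in P. z \<in> space P \<and> summable (\<lambda>t. noise t (\<lambda>i. \<omega> i z))"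
    by eventually_elim simp
  have 2: "AE z in P. convergent (\<lambda>t. G_loss A W lam (S t z))"
    using noise by eventually_elim (simp add: S_path path_asymptotics)
  have 3: "AE z in P. (\<lambda>t. norm (riem_grad (G_loss A W lam) (S t z))) \<longlonglongrightarrow> 0"
    using noise
  proof eventually_elim
    case (elim z)
    have "path u t \<in> manifold_M" for u t using path_in_region by (simp add: region_def)
    then show ?case using elim by (simp add: S_path path_asymptotics riem_grad_G_loss)
  qed
  have 4: "AE z in P. \<forall>l. (\<exists>r. strict_mono r \<and> (\<lambda>i. S (r i) z) \<longlonglongrightarrow> l) \<longrightarrow>
      stationary_point (G_loss A W lam) l"
    using noise
  proof eventually_elim
    case (elim z)
    then have "(\<lambda>t. S t z) = path (\<lambda>i. \<omega> i z)" by (simp add: fun_eq_iff S_path del: split_paired_All)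
    moreover note limit_point_stationary[OF path_asymptotics(2)[OF conjunct2[OF elim]]]
    ultimately show ?case by (auto simp: fun_eq_iff simp del: split_paired_All)
  qed
  show ?thesis using compact S_C subseq 2 3 4 by blast
qed

end
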